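(* Let $\lambda\in\mathbb{R}$, let $F_1,F_2:\mathbb{R}\to\mathbb{R}_+$ and let $\psi:\mathbb{R}^n\to\mathbb{R}\cup\{+\infty\}$ be convex. If $\lambda<0$ or $\lambda>1$, assume moreover that $F_1\circ\psi>0$ on $X_\psi$ and $F_2\circ\psi^*>0$ on $X_{\psi^*}$. Then $$as_\lambda(F_1,F_2,\psi)=as_{1-\lambda}(F_2,F_1,\psi^* ).$$
   Context: For a convex function $\psi:\mathbb{R}^n\to\mathbb{R}\cup\{+\infty\}$, $\Omega_\psi$ denotes the interior of the convex domain $\{x:\psi(x)<+\infty\}$; it is always assumed that $\Omega_\psi\neq\emptyset$. The Legendre transform is $\psi^*(y)=\sup_x(\langle x,y\rangle-\psi(x))$. The gradient $\nabla\psi$ and the Hessian $\nabla^2\psi$ in the sense of Alexandrov exist almost everywhere in $\Omega_\psi$. $X_\psi$ is the set of points of $\Omega_\psi$ at which the Alexandrov Hessian $\nabla^2\psi$ exists and is invertible; $X_{\psi^*}$ is defined in the same way from $\psi^*$. For functions $F_1,F_2$ on $\mathbb{R}$ and $\lambda\in\mathbb{R}$, $$as_\lambda(F_1,F_2,\psi)=\int_{X_\psi}\bigl(F_1(\psi(x))\bigr)^{1-\lambda}\bigl(F_2(\langle x,\nabla\psi(x)\rangle-\psi(x))\bigr)^{\lambda}\bigl(\det\nabla^2\psi(x)\bigr)^{\lambda}\,dx,$$ with the convention $0^0=1$. *)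

theory Defs
  imports "HOL-Analysis.Analysis"
begin

text \<open>
  Functions with values in \<open>\<real> \<union> {+\<infinity>}\<close> are functions into \<^typ>\<open>ereal\<close> that omit \<open>-\<infinity>\<close>.
  Convexity below is meant for such functions only: there, because \<open>0 * \<infinity> = 0\<close> in
  \<^typ>\<open>ereal\<close>, the instances \<open>u = 0\<close> and \<open>v = 0\<close> are trivially true.
\<close>

definition convex_ereal :: "('a::real_vector \<Rightarrow> ereal) \<Rightarrow> bool" where
  "convex_ereal \<psi> \<longleftrightarrow>
     (\<forall>x y. \<forall>u\<ge>0. \<forall>v\<ge>0. u + v = 1 \<longrightarrow>
        \<psi> (u *\<^sub>R x + v *\<^sub>R y) \<le> ereal u * \<psi> x + ereal v * \<psi> y)"

definition int_dom :: "('a::topological_space \<Rightarrow> ereal) \<Rightarrow> 'a set" where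
  "int_dom \<psi> = interior {x. \<psi> x < \<infinity>}"

definition legendre :: "('a::real_inner \<Rightarrow> ereal) \<Rightarrow> 'a \<Rightarrow> ereal" where
  "legendre \<psi> y = (SUP x. ereal (x \<bullet> y) - \<psi> x)"

text \<open>
  The next three definitions are only used at points of \<^term>\<open>int_dom \<psi>\<close>. Near such a point
  \<open>\<psi>\<close> is finite, so that \<open>real_of_ereal \<circ> \<psi>\<close> agrees with \<open>\<psi>\<close>.
\<close>

definition grad :: "('a::real_inner \<Rightarrow> ereal) \<Rightarrow> 'a \<Rightarrow> 'a" where
  "grad \<psi> x = (THE g. GDERIV (\<lambda>z. real_of_ereal (\<psi> z)) x :> g)"

text \<open>
  Hessian in the sense of Alexandrov: the gradient exists at \<open>x\<close> and
  \<open>\<psi> (x + h) = \<psi> x + \<langle>\<nabla>\<psi> x, h\<rangle> + 1/2 \<langle>A h, h\<rangle> + o(|h|\<^sup>2)\<close> as \<open>h \<rightarrow> 0\<close>.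
  Symmetry of \<open>A\<close> makes it unique, as the expansion only determines the quadratic form.
\<close>

definition has_alexandrov_hessian ::
    "(real^'n \<Rightarrow> ereal) \<Rightarrow> real^'n \<Rightarrow> real^'n^'n \<Rightarrow> bool" where
  "has_alexandrov_hessian \<psi> x A \<longleftrightarrow>
     transpose A = A \<and>
     (\<exists>g. GDERIV (\<lambda>z. real_of_ereal (\<psi> z)) x :> g \<and>
        ((\<lambda>h. (real_of_ereal (\<psi> (x + h)) - real_of_ereal (\<psi> x) - g \<bullet> h
                - (1/2) * ((A *v h) \<bullet> h)) / (norm h)\<^sup>2) \<longlongrightarrow> 0) (at 0))"

definition alexandrov_hessian :: "(real^'n \<Rightarrow> ereal) \<Rightarrow> real^'n \<Rightarrow> real^'n^'n" where
  "alexandrov_hessian \<psi> x = (THE A. has_alexandrov_hessian \<psi> x A)"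

definition regular_points :: "(real^'n \<Rightarrow> ereal) \<Rightarrow> (real^'n) set" where
  "regular_points \<psi> =
     {x \<in> int_dom \<psi>. \<exists>A. has_alexandrov_hessian \<psi> x A \<and> invertible A}"

text \<open>
  Powers of nonnegative reals with the convention \<open>0\<^sup>0 = 1\<close>; in the library, \<open>0 powr 0 = 0\<close>.
\<close>

definition rpow :: "real \<Rightarrow> real \<Rightarrow> real" where
  "rpow t a = (if a = 0 then 1 else t powr a)"

text \<open>
  The integrand is nonnegative, and the integral takes values in \<open>[0, \<infinity>]\<close>. For a
  non-measurable integrand the library's integral is the lower Lebesgue integral.
\<close>

definition affine_surface_area ::
    "real \<Rightarrow> (real \<Rightarrow> real) \<Rightarrow> (real \<Rightarrow> real) \<Rightarrow> (real^'n \<Rightarrow> ereal) \<Rightarrow> ennreal" where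
  "affine_surface_area lam F1 F2 \<psi> =
     (\<integral>\<^sup>+x\<in>regular_points \<psi>.
        ennreal (rpow (F1 (real_of_ereal (\<psi> x))) (1 - lam)
               * rpow (F2 (x \<bullet> grad \<psi> x - real_of_ereal (\<psi> x))) lam
               * rpow (det (alexandrov_hessian \<psi> x)) lam) \<partial>lebesgue)"

end

theory Submission
  imports Defs
begin

text \<open>
  Let \<open>X\<close> and \<open>Y\<close> be the sets of regular points of \<open>\<psi>\<close> and of its Legendre transform \<open>\<psi>\<^sup>*\<close>.
  The gradient map \<open>\<nabla>\<psi>\<close> is a bijection from \<open>X\<close> onto \<open>Y\<close> with inverse \<open>\<nabla>\<psi>\<^sup>*\<close>, and the
  identity of the two integrals is the change of variables \<open>y = \<nabla>\<psi>(x)\<close>.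

  \<^item> If \<open>\<psi>\<close> has at \<open>x\<close> the Alexandrov Hessian \<open>A\<close>, and \<open>A\<close> is invertible, then \<open>A\<close> is positive
    definite, and \<open>\<psi>\<^sup>*\<close> has at \<open>y = \<nabla>\<psi>(x)\<close> the gradient \<open>x\<close> and the Alexandrov Hessian
    \<open>A\<^sup>-\<^sup>1\<close> (\<open>legendre_expansion_bound\<close>, \<open>regular_points_legendre\<close>). Moreover
    \<open>\<psi>\<^sup>*(y) = \<langle>x, y\<rangle> - \<psi>(x)\<close> there, so the arguments of \<open>F1\<close> and \<open>F2\<close> correspond to each other,
    and \<open>(det A)\<^sup>\<lambda> = det A (det A\<^sup>-\<^sup>1)\<^bsup>1-\<lambda>\<^esup>\<close>.
  \<^item> The biconjugate \<open>\<psi>\<^sup>*\<^sup>*\<close> agrees with \<open>\<psi>\<close> on the interior of the domain, and both have the same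
    such interior (\<open>biconjugate_eq\<close>, \<open>int_dom_biconjugate\<close>). Hence \<open>\<nabla>\<psi>\<^sup>*\<close> maps \<open>Y\<close> back to \<open>X\<close>.
  \<^item> The second order expansion at \<open>x\<close> forces all subgradients at \<open>x + h\<close> to be
    \<open>\<nabla>\<psi>(x) + A h + o(|h|)\<close>. So \<open>\<nabla>\<psi>\<close>, as a map on \<open>X\<close>, is differentiable at each \<open>x \<in> X\<close> in the
    ordinary sense, with derivative \<open>A\<close> (\<open>grad_has_derivative\<close>), although \<open>X\<close> need not be open.
  \<^item> The integrands need not be measurable, and no measurability of \<open>X\<close> is used: for arbitrary \<open>f\<close>
    the lower integrals satisfy \<open>\<integral>\<^sub>X f(T x) |det DT(x)| dx \<le> \<integral>\<^sub>Y f\<close> whenever \<open>T\<close> is injective and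
    differentiable within \<open>X\<close> and maps \<open>X\<close> into \<open>Y\<close>
    (\<open>nn_integral_change_of_variables_le\<close>). Used for \<open>\<nabla>\<psi>\<close> and for its inverse, this gives
    equality. In particular Alexandrov's theorem on the existence almost everywhere of the
    Hessian is not needed.
\<close>

section \<open>Renaming coordinates\<close>

text \<open>
  The change of variables theorem for \<^typ>\<open>real^'m\<close> asks for a well-ordered index type. A copy of
  an arbitrary finite type, well-ordered by an enumeration, supplies one.
\<close>

typedef 'a enumerated = "UNIV :: 'a set"
  morphisms index_of enumerated_of ..

lemma bij_index_of: "bij index_of"
  by (metis UNIV_I bijI' enumerated_of_inverse index_of_inject)

instance enumerated :: (finite) finite
proof
  show "finite (UNIV :: 'a enumerated set)"
    by (rule bij_betw_finite[OF bij_index_of, THEN iffD2]) simp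
qed

instantiation enumerated :: (finite) wellorder
begin

text \<open>
  \<^term>\<open>to_nat_on UNIV\<close> is injective because the type is finite, hence countable.
\<close>

definition less_eq_enumerated where
  "(x :: 'a enumerated) \<le> y \<longleftrightarrow> to_nat_on UNIV x \<le> to_nat_on UNIV y"

definition less_enumerated where
  "(x :: 'a enumerated) < y \<longleftrightarrow> to_nat_on UNIV x < to_nat_on UNIV y"

instance
proof
  fix x y z :: "'a enumerated"
  have inj: "inj (to_nat_on (UNIV :: 'a enumerated set))"
    by (rule inj_on_to_nat_on) (simp add: countable_finite)
  show "x < y \<longleftrightarrow> x \<le> y \<and> \<not> y \<le> x" "x \<le> x" "x \<le> y \<or> y \<le> x"
    by (auto simp: less_eq_enumerated_def less_enumerated_def)
  show "x \<le> y \<Longrightarrow> y \<le> z \<Longrightarrow> x \<le> z"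
    by (auto simp: less_eq_enumerated_def)
  show "x \<le> y \<Longrightarrow> y \<le> x \<Longrightarrow> x = y"
    using inj by (auto simp: less_eq_enumerated_def inj_on_def)
next
  fix P :: "'a enumerated \<Rightarrow> bool" and a :: "'a enumerated"
  assume step: "\<And>x. (\<And>y. y < x \<Longrightarrow> P y) \<Longrightarrow> P x"
  show "P a"
  proof (induction "to_nat_on UNIV a" arbitrary: a rule: less_induct)
    case less
    show ?case
    proof (rule step)
      fix y assume "y < a"
      then show "P y"
        by (intro less) (simp add: less_enumerated_def)
    qed
  qed
qed

end

text \<open>
  Determinants do not change when rows and columns are renamed by the same bijection, as
  conjugation by a bijection preserves the sign of a permutation.
\<close>

lemma swapidseq_conjugate:
  assumes "swapidseq n p" and f: "bij f"
  shows "swapidseq n (f \<circ> p \<circ> inv f)"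
  using assms(1)
proof (induction rule: swapidseq.induct)
  case id
  then show ?case
    using f bij_is_surj[OF f] unfolding surj_iff by (simp add: id_def)
next
  case (comp_Suc n p a b)
  have tr: "f \<circ> Transposition.transpose a b = Transposition.transpose (f a) (f b) \<circ> f"
    using f by (auto simp: fun_eq_iff Transposition.transpose_def bij_def inj_eq)
  have "f \<circ> (Transposition.transpose a b \<circ> p) \<circ> inv f = (f \<circ> Transposition.transpose a b) \<circ> p \<circ> inv f"
    by (simp add: o_assoc)
  also have "\<dots> = Transposition.transpose (f a) (f b) \<circ> (f \<circ> p \<circ> inv f)"
    unfolding tr by (simp add: o_assoc)
  finally have eq: "f \<circ> (Transposition.transpose a b \<circ> p) \<circ> inv f =
      Transposition.transpose (f a) (f b) \<circ> (f \<circ> p \<circ> inv f)" .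
  have "f a \<noteq> f b"
    using comp_Suc.hyps f by (simp add: bij_def inj_eq)
  then show ?case
    unfolding eq by (rule swapidseq.comp_Suc[OF comp_Suc.IH])
qed

lemma sign_conjugate:
  fixes f :: "'a::finite \<Rightarrow> 'b::finite"
  assumes p: "p permutes UNIV" and f: "bij f"
  shows "sign (f \<circ> p \<circ> inv f) = sign p"
proof -
  obtain n where n: "swapidseq n p"
    using p by (meson permutation_permutes finite permutation_def)
  show ?thesis
    unfolding sign_def
    using evenperm_unique[OF n refl] evenperm_unique[OF swapidseq_conjugate[OF n f] refl] by simp
qed

lemma det_reindex:
  fixes A :: "'a::comm_ring_1^'n^'n" and \<sigma> :: "'m::finite \<Rightarrow> 'n"
  assumes \<sigma>: "bij \<sigma>"
  shows "det (\<chi> i j. A $ \<sigma> i $ \<sigma> j) = det A"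
proof -
  let ?c = "\<lambda>p. \<sigma> \<circ> p \<circ> inv \<sigma>" and ?d = "\<lambda>p. inv \<sigma> \<circ> p \<circ> \<sigma>"
  have inv1: "\<sigma> (inv \<sigma> y) = y" and inv2: "inv \<sigma> (\<sigma> x) = x" for x y
    using \<sigma> by (auto simp: bij_def surj_f_inv_f)
  have bij_inv: "bij (inv \<sigma>)"
    using \<sigma> by (rule bij_imp_bij_inv)
  have perm_iff: "p permutes UNIV \<longleftrightarrow> bij p" for p :: "'x \<Rightarrow> 'x"
    using bij_imp_permutes permutes_bij by blast
  show ?thesis
    unfolding det_def
  proof (rule sum.reindex_bij_witness[where j="?c" and i="?d"])
    fix p :: "'m \<Rightarrow> 'm" assume p: "p \<in> {p. p permutes UNIV}"
    show "?d (?c p) = p" by (simp add: fun_eq_iff inv2)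
    show "?c p \<in> {p. p permutes UNIV}"
      using p \<sigma> bij_inv by (auto simp: perm_iff intro!: bij_comp)
    have "(\<Prod>i\<in>UNIV. A $ i $ ?c p i) = (\<Prod>i\<in>UNIV. A $ \<sigma> i $ ?c p (\<sigma> i))"
      using \<sigma> by (intro prod.reindex_bij_betw[symmetric]) 
    then show "of_int (sign (?c p)) * (\<Prod>i\<in>UNIV. A $ i $ ?c p i) =
        of_int (sign p) * (\<Prod>i\<in>UNIV. (\<chi> i j. A $ \<sigma> i $ \<sigma> j) $ i $ p i)"
      using sign_conjugate[of p \<sigma>] p \<sigma> by (simp add: inv2)
  next
    fix p :: "'n \<Rightarrow> 'n" assume p: "p \<in> {p. p permutes UNIV}"
    show "?c (?d p) = p" by (simp add: fun_eq_iff inv1)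
    show "?d p \<in> {p. p permutes UNIV}"
      using p \<sigma> bij_inv by (auto simp: perm_iff intro!: bij_comp)
  qed
qed

text \<open>
  Transport of integrals along a measurable isomorphism. No measurability of \<open>f\<close> is assumed,
  in contrast to the transport along a mere measurable map.
\<close>

lemma nn_integral_distr_bij:
  assumes T: "T \<in> M \<rightarrow>\<^sub>M N" and S: "S \<in> N \<rightarrow>\<^sub>M M"
    and ST: "\<And>x. x \<in> space M \<Longrightarrow> S (T x) = x" and TS: "\<And>y. y \<in> space N \<Longrightarrow> T (S y) = y"
  shows "(\<integral>\<^sup>+y. f y \<partial>distr M N T) = (\<integral>\<^sup>+x. f (T x) \<partial>M)"
proof (rule antisym)
  note T [measurable] and S [measurable]
  show "(\<integral>\<^sup>+y. f y \<partial>distr M N T) \<le> (\<integral>\<^sup>+x. f (T x) \<partial>M)"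
    unfolding nn_integral_def[of "distr M N T"]
  proof (safe intro!: SUP_least)
    fix g assume g: "simple_function (distr M N T) g" and le: "g \<le> f"
    have gm [measurable]: "g \<in> borel_measurable N"
      using borel_measurable_simple_function[OF g] by simp
    have "integral\<^sup>S (distr M N T) g = (\<integral>\<^sup>+y. g y \<partial>distr M N T)"
      by (rule nn_integral_eq_simple_integral[OF g, symmetric])
    also have "\<dots> = (\<integral>\<^sup>+x. g (T x) \<partial>M)"
      by (rule nn_integral_distr[OF T]) simp
    also have "\<dots> \<le> (\<integral>\<^sup>+x. f (T x) \<partial>M)"
      using le by (intro nn_integral_mono) (auto simp: le_fun_def)
    finally show "integral\<^sup>S (distr M N T) g \<le> (\<integral>\<^sup>+x. f (T x) \<partial>M)" .
  qed
  show "(\<integral>\<^sup>+x. f (T x) \<partial>M) \<le> (\<integral>\<^sup>+y. f y \<partial>distr M N T)"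
    unfolding nn_integral_def[of M]
  proof (safe intro!: SUP_least)
    fix g assume g: "simple_function M g" and le: "g \<le> (\<lambda>x. f (T x))"
    have gm [measurable]: "g \<in> borel_measurable M"
      using borel_measurable_simple_function[OF g] .
    have "integral\<^sup>S M g = (\<integral>\<^sup>+x. g x \<partial>M)"
      by (rule nn_integral_eq_simple_integral[OF g, symmetric])
    also have "\<dots> = (\<integral>\<^sup>+x. g (S (T x)) \<partial>M)"
      by (rule nn_integral_cong) (simp add: ST)
    also have "\<dots> = (\<integral>\<^sup>+y. g (S y) \<partial>distr M N T)"
      by (rule nn_integral_distr[OF T, symmetric]) simp
    also have "\<dots> \<le> (\<integral>\<^sup>+y. f y \<partial>distr M N T)"
    proof (rule nn_integral_mono)
      fix y assume "y \<in> space (distr M N T)"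
      then have "T (S y) = y" by (simp add: TS)
      then show "g (S y) \<le> f y" using le_funD[OF le, of "S y"] by simp
    qed
    finally show "integral\<^sup>S M g \<le> (\<integral>\<^sup>+y. f y \<partial>distr M N T)" .
  qed
qed

text \<open>
  Renaming of coordinates along \<open>\<sigma>\<close>; for bijective \<open>\<sigma>\<close> an isomorphism that preserves Lebesgue
  measure.
\<close>

definition reindex :: "('m \<Rightarrow> 'n) \<Rightarrow> 'a^'n \<Rightarrow> 'a^'m" where
  "reindex \<sigma> v = (\<chi> i. v $ \<sigma> i)"

lemma reindex_nth [simp]: "reindex \<sigma> v $ i = v $ \<sigma> i"
  by (simp add: reindex_def)

lemma linear_reindex: "linear (reindex \<sigma> :: real^'n \<Rightarrow> real^'m)"
  by (rule linearI) (auto simp: vec_eq_iff)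

lemma borel_measurable_reindex [measurable]:
  "(reindex \<sigma> :: real^'n \<Rightarrow> real^'m) \<in> borel_measurable borel"
  by (intro borel_measurable_continuous_onI linear_continuous_on
      linear_conv_bounded_linear[THEN iffD1] linear_reindex)

lemma reindex_inv:
  assumes "bij \<sigma>"
  shows "reindex \<sigma> (reindex (inv \<sigma>) v) = v" "reindex (inv \<sigma>) (reindex \<sigma> w) = w"
  using assms by (auto simp: vec_eq_iff bij_def surj_f_inv_f)

lemma distr_lborel_reindex:
  fixes \<sigma> :: "'m::finite \<Rightarrow> 'n::finite"
  assumes \<sigma>: "bij \<sigma>"
  shows "distr lborel borel (reindex \<sigma> :: real^'n \<Rightarrow> real^'m) = lborel"
proof (rule lborel_eqI[symmetric])
  have meas: "(reindex \<sigma> :: real^'n \<Rightarrow> real^'m) \<in> borel_measurable lborel"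
    using borel_measurable_reindex by simp
  fix l u :: "real^'m"
  assume le: "\<And>b. b \<in> Basis \<Longrightarrow> l \<bullet> b \<le> u \<bullet> b"
  have le': "l $ i \<le> u $ i" for i
    using le[of "axis i 1"] by (simp add: inner_axis axis_in_Basis_iff)
  have prod_Basis: "(\<Prod>b\<in>Basis. v \<bullet> b) = (\<Prod>i\<in>UNIV. v $ i)" for v :: "real^'x::finite"
  proof -
    have "(\<Prod>b\<in>range (\<lambda>i::'x. axis i (1::real)). v \<bullet> b) = (\<Prod>i\<in>UNIV. v $ i)"
      by (subst prod.reindex) (auto simp: inj_on_def axis_eq_axis inner_axis)
    moreover have "(Basis :: (real^'x) set) = range (\<lambda>i. axis i 1)"
      by (auto simp: Basis_vec_def)
    ultimately show ?thesis by simp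
  qed
  have box: "reindex \<sigma> -` box l u = box (reindex (inv \<sigma>) l) (reindex (inv \<sigma>) u)"
  proof (rule set_eqI)
    fix v :: "real^'n"
    have "(\<forall>j. l $ inv \<sigma> j < v $ j \<and> v $ j < u $ inv \<sigma> j) \<longleftrightarrow>
        (\<forall>j\<in>range \<sigma>. l $ inv \<sigma> j < v $ j \<and> v $ j < u $ inv \<sigma> j)"
      using \<sigma> by (simp add: bij_is_surj)
    also have "\<dots> \<longleftrightarrow> (\<forall>i. l $ i < v $ \<sigma> i \<and> v $ \<sigma> i < u $ i)"
      using \<sigma> by (simp add: bij_is_inj)
    finally
    show "v \<in> reindex \<sigma> -` box l u \<longleftrightarrow> v \<in> box (reindex (inv \<sigma>) l) (reindex (inv \<sigma>) u)"
      by (simp add: mem_box_cart)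
  qed
  have "emeasure (distr lborel borel (reindex \<sigma>)) (box l u)
      = emeasure lborel (box (reindex (inv \<sigma>) l) (reindex (inv \<sigma>) u) :: (real^'n) set)"
    using meas by (subst emeasure_distr) (auto simp: box)
  also have "\<dots> = (\<Prod>b\<in>Basis. (reindex (inv \<sigma>) u - reindex (inv \<sigma>) l :: real^'n) \<bullet> b)"
    by (rule emeasure_lborel_box) (auto simp: Basis_vec_def inner_axis le')
  also have "\<dots> = (\<Prod>j\<in>UNIV. (u - l) $ inv \<sigma> j)"
    by (simp add: prod_Basis)
  also have "(\<Prod>j\<in>UNIV. (u - l) $ inv \<sigma> j) = (\<Prod>i\<in>UNIV. (u - l) $ i)"
    using bij_imp_bij_inv[OF \<sigma>] by (intro prod.reindex_bij_betw)
  also have "\<dots> = (\<Prod>b\<in>Basis. (u - l) \<bullet> b)"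
    by (rule prod_Basis[symmetric])
  finally show "emeasure (distr lborel borel (reindex \<sigma>)) (box l u) = (\<Prod>b\<in>Basis. (u - l) \<bullet> b)" .
qed simp

lemma nn_integral_lebesgue_reindex:
  fixes \<sigma> :: "'m::finite \<Rightarrow> 'n::finite" and f :: "real^'m \<Rightarrow> ennreal"
  assumes \<sigma>: "bij \<sigma>"
  shows "(\<integral>\<^sup>+v. f (reindex \<sigma> v) \<partial>lebesgue) = (\<integral>\<^sup>+w. f w \<partial>lebesgue)"
proof -
  have "(\<integral>\<^sup>+w. f w \<partial>distr lborel borel (reindex \<sigma>)) = (\<integral>\<^sup>+v. f (reindex \<sigma> v) \<partial>lborel)"
  proof (rule nn_integral_distr_bij[where S="reindex (inv \<sigma>)"])
    show "reindex \<sigma> \<in> lborel \<rightarrow>\<^sub>M (borel :: (real^'m) measure)"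
      using borel_measurable_reindex[of \<sigma>] by simp
    show "reindex (inv \<sigma>) \<in> borel \<rightarrow>\<^sub>M (lborel :: (real^'n) measure)"
      using borel_measurable_reindex[of "inv \<sigma>"] by simp
  qed (simp_all add: reindex_inv[OF \<sigma>])
  then show ?thesis
    by (simp add: distr_lborel_reindex[OF \<sigma>] nn_integral_completion)
qed

section \<open>Change of variables for lower integrals\<close>

text \<open>
  The lower integral on the left is the supremum over simple functions \<open>g\<close> below the integrand.
  The support of such a \<open>g\<close> is a measurable subset of \<open>X\<close>, and there the change of variables theorem
  for integrable functions applies to \<open>g\<close> itself; so neither \<open>X\<close>, \<open>Y\<close> nor \<open>f\<close> has to be measurable.
\<close>

lemma nn_integral_change_of_variables_le_wellorder:
  fixes T :: "real^'m::{finite,wellorder} \<Rightarrow> real^'m::_" and D :: "real^'m::_ \<Rightarrow> real^'m::_^'m::_"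
    and f :: "real^'m::_ \<Rightarrow> ennreal"
  assumes der: "\<And>x. x \<in> X \<Longrightarrow> (T has_derivative (\<lambda>h. D x *v h)) (at x within X)"
    and inj: "inj_on T X" and sub: "T ` X \<subseteq> Y"
  shows "(\<integral>\<^sup>+x\<in>X. ennreal \<bar>det (D x)\<bar> * f (T x) \<partial>lebesgue) \<le> (\<integral>\<^sup>+y\<in>Y. f y \<partial>lebesgue)"
  unfolding nn_integral_def_finite[of lebesgue "\<lambda>x. (ennreal \<bar>det (D x)\<bar> * f (T x)) * indicator X x"]
proof (safe intro!: SUP_least)
  fix g :: "real^'m::_ \<Rightarrow> ennreal"
  assume g: "simple_function lebesgue g"
    and gle: "g \<le> (\<lambda>x. (ennreal \<bar>det (D x)\<bar> * f (T x)) * indicator X x)"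
    and gfin: "\<forall>x. g x < top"
  \<comment> \<open>The support of \<open>g\<close> may have infinite measure; it is exhausted by bounded pieces.\<close>
  define P where "P k = {x. g x \<noteq> 0} \<inter> ball 0 (real k)" for k :: nat
  define r where "r x = enn2real (g x)" for x
  have gr: "g x = ennreal (r x)" for x
    using gfin by (simp add: r_def less_top)
  have r_nonneg: "0 \<le> r x" for x
    by (simp add: r_def)
  have gmeas [measurable]: "g \<in> borel_measurable lebesgue"
    using g by (rule borel_measurable_simple_function)
  have rmeas [measurable]: "r \<in> borel_measurable lebesgue"
    unfolding r_def by measurable
  have P_sets [measurable]: "P k \<in> sets lebesgue" for k
  proof -
    have "{x \<in> space lebesgue. g x \<noteq> 0} \<in> sets lebesgue"
      by measurable
    moreover have "ball 0 (real k) \<in> sets (lebesgue :: (real^'m::_) measure)"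
      by (simp add: borel_open)
    ultimately show ?thesis
      unfolding P_def by auto
  qed
  have PX: "P k \<subseteq> X" for k
  proof
    fix x assume "x \<in> P k"
    then have "g x \<noteq> 0" by (simp add: P_def)
    with le_funD[OF gle, of x] show "x \<in> X"
      by (cases "x \<in> X") auto
  qed
  obtain B where B: "\<And>x. r x \<le> B"
  proof -
    have "finite (r ` UNIV)"
      using simple_functionD(1)[OF g] unfolding r_def by (simp add: image_image[symmetric])
    then have "bdd_above (r ` UNIV)" by (rule bdd_above_finite)
    then show thesis using that by (auto simp: bdd_above_def)
  qed
  define S where "S = inv_into X T"
  have ST: "S (T x) = x" if "x \<in> X" for x
    using that inj by (simp add: S_def)
  \<comment> \<open>Division by zero gives \<open>h (T x) = 0\<close> where the determinant vanishes; there \<open>g\<close> vanishes too.\<close>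
  define h where "h y = r (S y) / \<bar>det (D (S y))\<bar>" for y
  have h_nonneg: "0 \<le> h y" for y
    by (simp add: h_def r_nonneg)
  have rdet: "r x = \<bar>det (D x)\<bar> * h (T x)" if "x \<in> X" for x
  proof (cases "det (D x) = 0")
    case True
    then have "r x = 0"
      using le_funD[OF gle, of x] by (simp add: r_def)
    with True show ?thesis by simp
  qed (simp add: h_def ST that)
  have hf: "ennreal (h (T x)) \<le> f (T x)" if "x \<in> X" for x
  proof (cases "det (D x) = 0")
    case True
    then show ?thesis by (simp add: h_def ST that)
  next
    case False
    have "ennreal \<bar>det (D x)\<bar> * ennreal (h (T x)) = g x"
      unfolding gr rdet[OF that] by (simp add: ennreal_mult h_nonneg)
    also have "\<dots> \<le> ennreal \<bar>det (D x)\<bar> * f (T x)"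
      using le_funD[OF gle, of x] that by simp
    finally show ?thesis
      using False by (subst (asm) ennreal_mult_le_mult_iff) (auto simp: ennreal_eq_0_iff)
  qed
  have piece: "(\<integral>\<^sup>+x. g x * indicator (P k) x \<partial>lebesgue) \<le> (\<integral>\<^sup>+y\<in>Y. f y \<partial>lebesgue)" for k
  proof -
    have "integrable lebesgue (\<lambda>x. indicator (P k) x *\<^sub>R r x)"
    proof (rule integrableI_bounded_set[where A="P k" and B=B])
      have "emeasure lebesgue (P k) \<le> emeasure lebesgue (ball 0 (real k) :: (real^'m::_) set)"
        by (rule emeasure_mono) (auto simp: P_def borel_open)
      also have "\<dots> < \<infinity>"
        using lmeasurable_ball[of "0::real^'m::_" "real k"] by (simp add: fmeasurable_def)
      finally show "emeasure lebesgue (P k) < \<infinity>" .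
    qed (use B r_nonneg in \<open>auto simp: indicator_def\<close>)
    then have abs_r: "r absolutely_integrable_on (P k)"
      by (simp add: set_integrable_def)
    then have r_int: "(r has_integral integral (P k) r) (P k)"
      by (simp add: absolutely_integrable_on_def has_integral_iff)
    let ?b = "integral (P k) r"
    \<comment> \<open>The change of variables theorem is about vector-valued functions, hence \<^typ>\<open>real^1\<close>.\<close>
    let ?F = "\<lambda>y. vec (h y) :: real^1"
    have eq: "\<And>x. x \<in> P k \<Longrightarrow> \<bar>det (matrix (\<lambda>v. D x *v v))\<bar> *\<^sub>R ?F (T x) = vec (r x)"
      using rdet[OF subsetD[OF PX]] by (simp add: vec_eq_iff matrix_of_matrix_vector_mul)
    have "(\<lambda>x. vec (r x) :: real^1) absolutely_integrable_on P k"
      using abs_r by (simp add: absolutely_integrable_on_1_iff)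
    then have 1: "(\<lambda>x. \<bar>det (matrix (\<lambda>v. D x *v v))\<bar> *\<^sub>R ?F (T x)) absolutely_integrable_on P k"
      by (subst set_integrable_cong[OF refl refl eq]) auto
    have "integral (P k) (\<lambda>x. vec (r x) :: real^1) = vec ?b"
      by (subst integral_on_1_eq) simp
    then have 2: "integral (P k) (\<lambda>x. \<bar>det (matrix (\<lambda>v. D x *v v))\<bar> *\<^sub>R ?F (T x)) = vec ?b"
      by (subst integral_cong[OF eq]) auto
    have "?F absolutely_integrable_on (T ` P k) \<and> integral (T ` P k) ?F = vec ?b"
      using has_absolute_integral_change_of_variables
        [of "P k" T "\<lambda>x v. D x *v v" ?F "vec ?b", OF P_sets _ inj_on_subset[OF inj PX]]
        1 2 has_derivative_subset[OF der[OF subsetD[OF PX]] PX] by blast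
    then have "h absolutely_integrable_on (T ` P k)" "integral (T ` P k) h = ?b"
      by (auto simp: absolutely_integrable_on_1_iff integral_on_1_eq vec_eq_iff)
    then have h_int: "(h has_integral ?b) (T ` P k)"
      by (metis absolutely_integrable_on_def has_integral_iff)
    have "(\<integral>\<^sup>+x. g x * indicator (P k) x \<partial>lebesgue) = (\<integral>\<^sup>+x. ennreal (r x) * indicator (P k) x \<partial>lborel)"
      by (simp add: nn_integral_completion gr)
    also have "\<dots> = ennreal ?b"
      by (rule nn_integral_has_integral_lebesgue'[OF r_nonneg r_int])
    also have "\<dots> = (\<integral>\<^sup>+y. ennreal (h y) * indicator (T ` P k) y \<partial>lborel)"
      by (rule nn_integral_has_integral_lebesgue'[OF _ h_int, symmetric])
         (rule h_nonneg)
    also have "\<dots> \<le> (\<integral>\<^sup>+y\<in>Y. f y \<partial>lborel)"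
    proof (rule nn_integral_mono)
      fix y
      show "ennreal (h y) * indicator (T ` P k) y \<le> f y * indicator Y y"
      proof (cases "y \<in> T ` P k")
        case True
        then obtain x where x: "x \<in> P k" "y = T x" by blast
        then have "x \<in> X" using PX by blast
        then have "y \<in> Y" using sub x(2) by blast
        with hf[OF \<open>x \<in> X\<close>] True x(2) show ?thesis by simp
      qed simp
    qed
    finally show ?thesis by (simp add: nn_integral_completion)
  qed
  have "integral\<^sup>S lebesgue g = (\<integral>\<^sup>+x. g x \<partial>lebesgue)"
    by (rule nn_integral_eq_simple_integral[OF g, symmetric])
  also have "\<dots> = (\<integral>\<^sup>+x. (SUP k. g x * indicator (P k) x) \<partial>lebesgue)"
  proof (rule nn_integral_cong)
    fix x :: "real^'m::_"
    obtain k :: nat where k: "norm x < real k"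
      using reals_Archimedean2 by blast
    have "g x \<le> g x * indicator (P k) x"
      using k by (auto simp: P_def indicator_def)
    then have "g x \<le> (SUP k. g x * indicator (P k) x)"
      by (meson SUP_upper2 UNIV_I)
    moreover have "(SUP k. g x * indicator (P k) x) \<le> g x"
      by (rule SUP_least) (simp add: indicator_def)
    ultimately show "g x = (SUP k. g x * indicator (P k) x)" by simp
  qed
  also have "\<dots> = (SUP k. \<integral>\<^sup>+x. g x * indicator (P k) x \<partial>lebesgue)"
  proof (rule nn_integral_monotone_convergence_SUP)
    show "incseq (\<lambda>k x. g x * indicator (P k) x)"
      by (auto simp: incseq_def le_fun_def P_def indicator_def)
  qed measurable
  also have "\<dots> \<le> (\<integral>\<^sup>+y\<in>Y. f y \<partial>lebesgue)"
    by (rule SUP_least) (rule piece)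
  finally show "integral\<^sup>S lebesgue g \<le> (\<integral>\<^sup>+y\<in>Y. f y \<partial>lebesgue)" .
qed

text \<open>
  The same inequality for an arbitrary finite index type, by renaming the coordinates.
\<close>

lemma nn_integral_change_of_variables_le:
  fixes T :: "real^'n \<Rightarrow> real^'n" and D :: "real^'n \<Rightarrow> real^'n^'n" and f :: "real^'n \<Rightarrow> ennreal"
  assumes der: "\<And>x. x \<in> X \<Longrightarrow> (T has_derivative (\<lambda>h. D x *v h)) (at x within X)"
    and inj: "inj_on T X" and sub: "T ` X \<subseteq> Y"
  shows "(\<integral>\<^sup>+x\<in>X. ennreal \<bar>det (D x)\<bar> * f (T x) \<partial>lebesgue) \<le> (\<integral>\<^sup>+y\<in>Y. f y \<partial>lebesgue)"
proof -
  define \<sigma> :: "'n enumerated \<Rightarrow> 'n" where "\<sigma> = index_of"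
  have \<sigma>: "bij \<sigma>"
    unfolding \<sigma>_def by (rule bij_index_of)
  define \<rho> where "\<rho> = (reindex \<sigma> :: real^'n \<Rightarrow> real^'n enumerated)"
  define \<rho>' where "\<rho>' = (reindex (inv \<sigma>) :: real^'n enumerated \<Rightarrow> real^'n)"
  have inv [simp]: "\<rho> (\<rho>' w) = w" "\<rho>' (\<rho> v) = v" for v w
    unfolding \<rho>_def \<rho>'_def using reindex_inv[OF \<sigma>] by auto
  have bl: "bounded_linear \<rho>" "bounded_linear \<rho>'"
    unfolding \<rho>_def \<rho>'_def by (simp_all add: linear_reindex linear_conv_bounded_linear[symmetric])
  define T1 where "T1 = \<rho> \<circ> T \<circ> \<rho>'"
  define D1 where "D1 w = (\<chi> i j. D (\<rho>' w) $ \<sigma> i $ \<sigma> j)" for w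
  have mem: "w \<in> \<rho> ` Z \<longleftrightarrow> \<rho>' w \<in> Z" for w Z
    by (metis image_iff inv)
  have ind: "indicator (\<rho> ` Z) w = (indicator Z (\<rho>' w) :: ennreal)" for w Z
    by (simp add: indicator_def mem)
  have D1_eq: "D1 w *v h = \<rho> (D (\<rho>' w) *v \<rho>' h)" for w h
  proof (subst vec_eq_iff, rule allI)
    fix i
    have "(\<Sum>j\<in>UNIV. D (\<rho>' w) $ \<sigma> i $ \<sigma> j * h $ inv \<sigma> (\<sigma> j))
        = (\<Sum>k\<in>UNIV. D (\<rho>' w) $ \<sigma> i $ k * h $ inv \<sigma> k)"
      using \<sigma> by (rule sum.reindex_bij_betw)
    then show "(D1 w *v h) $ i = \<rho> (D (\<rho>' w) *v \<rho>' h) $ i"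
      using \<sigma> by (simp add: D1_def \<rho>_def \<rho>'_def matrix_vector_mult_def bij_is_inj)
  qed
  have im: "\<rho>' ` \<rho> ` X = X"
    by (auto simp: image_image)
  have der1: "(T1 has_derivative (\<lambda>h. D1 w *v h)) (at w within \<rho> ` X)" if "w \<in> \<rho> ` X" for w
  proof -
    have "(T has_derivative (\<lambda>h. D (\<rho>' w) *v h)) (at (\<rho>' w) within \<rho>' ` \<rho> ` X)"
      using der[of "\<rho>' w"] that by (simp add: mem im)
    from diff_chain_within[OF bounded_linear_imp_has_derivative[OF bl(2)] this]
    have "(T \<circ> \<rho>' has_derivative (\<lambda>h. D (\<rho>' w) *v h) \<circ> \<rho>') (at w within \<rho> ` X)" .
    from diff_chain_within[OF this bounded_linear_imp_has_derivative[OF bl(1)]]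
    show ?thesis
      by (simp add: T1_def D1_eq o_def)
  qed
  have inj1: "inj_on T1 (\<rho> ` X)"
    using inj unfolding T1_def inj_on_def by (metis comp_apply inv(1,2) mem)
  have sub1: "T1 ` \<rho> ` X \<subseteq> \<rho> ` Y"
    using sub by (auto simp: T1_def)
  have det1: "det (D1 w) = det (D (\<rho>' w))" for w
    unfolding D1_def by (rule det_reindex[OF \<sigma>])
  have "(\<integral>\<^sup>+x\<in>X. ennreal \<bar>det (D x)\<bar> * f (T x) \<partial>lebesgue)
      = (\<integral>\<^sup>+w\<in>\<rho> ` X. ennreal \<bar>det (D1 w)\<bar> * f (\<rho>' (T1 w)) \<partial>lebesgue)"
    using nn_integral_lebesgue_reindex[OF bij_imp_bij_inv[OF \<sigma>],
        of "\<lambda>x. ennreal \<bar>det (D x)\<bar> * f (T x) * indicator X x"]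
    by (simp add: ind det1 T1_def flip: \<rho>'_def)
  also have "\<dots> \<le> (\<integral>\<^sup>+w\<in>\<rho> ` Y. f (\<rho>' w) \<partial>lebesgue)"
    by (rule nn_integral_change_of_variables_le_wellorder[OF der1 inj1 sub1])
  also have "\<dots> = (\<integral>\<^sup>+y\<in>Y. f y \<partial>lebesgue)"
    using nn_integral_lebesgue_reindex[OF bij_imp_bij_inv[OF \<sigma>], of "\<lambda>y. f y * indicator Y y"]
    by (simp add: ind flip: \<rho>'_def)
  finally show ?thesis .
qed

text \<open>
  The reverse inequality is the previous lemma for the inverse map \<open>S\<close> and the function
  \<open>x \<mapsto> |det D(x)| f(T x)\<close>.
\<close>

lemma nn_integral_change_of_variables_eq:
  fixes T S :: "real^'n \<Rightarrow> real^'n" and D E :: "real^'n \<Rightarrow> real^'n^'n" and f :: "real^'n \<Rightarrow> ennreal"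
  assumes T_der: "\<And>x. x \<in> X \<Longrightarrow> (T has_derivative (\<lambda>h. D x *v h)) (at x within X)"
    and S_der: "\<And>y. y \<in> Y \<Longrightarrow> (S has_derivative (\<lambda>h. E y *v h)) (at y within Y)"
    and T_im: "\<And>x. x \<in> X \<Longrightarrow> T x \<in> Y" and S_im: "\<And>y. y \<in> Y \<Longrightarrow> S y \<in> X"
    and ST: "\<And>x. x \<in> X \<Longrightarrow> S (T x) = x" and TS: "\<And>y. y \<in> Y \<Longrightarrow> T (S y) = y"
    and det: "\<And>y. y \<in> Y \<Longrightarrow> det (E y) * det (D (S y)) = 1"
  shows "(\<integral>\<^sup>+x\<in>X. ennreal \<bar>det (D x)\<bar> * f (T x) \<partial>lebesgue) = (\<integral>\<^sup>+y\<in>Y. f y \<partial>lebesgue)"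
proof (rule antisym)
  show "(\<integral>\<^sup>+x\<in>X. ennreal \<bar>det (D x)\<bar> * f (T x) \<partial>lebesgue) \<le> (\<integral>\<^sup>+y\<in>Y. f y \<partial>lebesgue)"
    using T_im by (intro nn_integral_change_of_variables_le T_der inj_on_inverseI[where g=S] ST) auto
  have "(\<integral>\<^sup>+y\<in>Y. f y \<partial>lebesgue)
      = (\<integral>\<^sup>+y\<in>Y. ennreal \<bar>det (E y)\<bar> * (ennreal \<bar>det (D (S y))\<bar> * f (T (S y))) \<partial>lebesgue)"
  proof (intro nn_integral_cong)
    fix y
    have "ennreal \<bar>det (E y)\<bar> * (ennreal \<bar>det (D (S y))\<bar> * f (T (S y))) = f y" if "y \<in> Y"
    proof -
      have "ennreal \<bar>det (E y)\<bar> * ennreal \<bar>det (D (S y))\<bar> = 1"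
        using det[OF that] by (simp add: abs_mult[symmetric] flip: ennreal_mult)
      then show ?thesis
        using TS[OF that] by (simp add: mult.assoc[symmetric])
    qed
    then show "f y * indicator Y y =
        ennreal \<bar>det (E y)\<bar> * (ennreal \<bar>det (D (S y))\<bar> * f (T (S y))) * indicator Y y"
      by (simp add: indicator_def)
  qed
  also have "\<dots> \<le> (\<integral>\<^sup>+x\<in>X. ennreal \<bar>det (D x)\<bar> * f (T x) \<partial>lebesgue)"
    using S_im by (intro nn_integral_change_of_variables_le S_der inj_on_inverseI[where g=T] TS) auto
  finally show "(\<integral>\<^sup>+y\<in>Y. f y \<partial>lebesgue) \<le> (\<integral>\<^sup>+x\<in>X. ennreal \<bar>det (D x)\<bar> * f (T x) \<partial>lebesgue)" .
qed

section \<open>Second order expansions\<close>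

text \<open>
  Second order Taylor expansion \<open>\<phi>(x + h) = \<phi>(x) + \<langle>g, h\<rangle> + 1/2 \<langle>A h, h\<rangle> + o(|h|\<^sup>2)\<close>, with the
  error term in \<open>\<epsilon>\<close>-\<open>\<delta>\<close> form. Symmetry of \<open>A\<close> is not part of the notion.
\<close>

definition second_order_expansion ::
    "(real^'n \<Rightarrow> real) \<Rightarrow> real^'n \<Rightarrow> real^'n \<Rightarrow> real^'n^'n \<Rightarrow> bool" where
  "second_order_expansion \<phi> x g A \<longleftrightarrow>
     (\<forall>e>0. \<exists>d>0. \<forall>h. norm h \<le> d \<longrightarrow>
        \<bar>\<phi> (x + h) - \<phi> x - g \<bullet> h - (1/2) * ((A *v h) \<bullet> h)\<bar> \<le> e * (norm h)\<^sup>2)"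

lemma inner_matrix_vector_symmetric:
  fixes A :: "real^'n^'n"
  assumes "transpose A = A"
  shows "(A *v x) \<bullet> y = (A *v y) \<bullet> x"
  by (metis assms dot_lmul_matrix inner_commute vector_transpose_matrix)

lemma matrix_vector_mult_bound:
  fixes A :: "real^'n^'n"
  obtains M where "M > 0" "\<And>h. norm (A *v h) \<le> M * norm h"
  using bounded_linear.pos_bounded[OF matrix_vector_mul_bounded_linear[of A]]
  by (metis mult.commute)

lemma quadratic_form_bound:
  fixes A :: "real^'n^'n"
  assumes M: "\<And>h. norm (A *v h) \<le> M * norm h"
  shows "\<bar>(A *v h) \<bullet> h\<bar> \<le> M * (norm h)\<^sup>2"
proof -
  have "\<bar>(A *v h) \<bullet> h\<bar> \<le> norm (A *v h) * norm h"
    by (rule Cauchy_Schwarz_ineq2)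
  also have "\<dots> \<le> M * norm h * norm h"
    using M by (intro mult_right_mono) auto
  finally show ?thesis by (simp add: power2_eq_square mult.assoc)
qed

lemma second_order_expansion_imp_GDERIV:
  assumes "second_order_expansion \<phi> x g A"
  shows "GDERIV \<phi> x :> g"
  unfolding gderiv_def has_derivative_at_alt
proof (intro conjI allI impI)
  show "bounded_linear (\<lambda>h. h \<bullet> g)"
    by (rule bounded_linear_inner_left)
  fix e :: real assume e: "0 < e"
  obtain M where M: "M > 0" "\<And>h. norm (A *v h) \<le> M * norm h"
    using matrix_vector_mult_bound[of A] by metis
  obtain d where d: "d > 0" and exp: "\<And>h. norm h \<le> d \<Longrightarrow>
      \<bar>\<phi> (x + h) - \<phi> x - g \<bullet> h - (1/2) * ((A *v h) \<bullet> h)\<bar> \<le> 1 * (norm h)\<^sup>2"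
    using assms unfolding second_order_expansion_def by (meson zero_less_one)
  show "\<exists>d>0. \<forall>y. norm (y - x) < d \<longrightarrow> norm (\<phi> y - \<phi> x - (y - x) \<bullet> g) \<le> e * norm (y - x)"
  proof (intro exI conjI allI impI)
    show "0 < min d (e / (M + 1))"
      using d e M by simp
    fix y assume y: "norm (y - x) < min d (e / (M + 1))"
    define h where "h = y - x"
    have "\<bar>\<phi> (x + h) - \<phi> x - g \<bullet> h\<bar> \<le> 1 * (norm h)\<^sup>2 + (1/2) * (M * (norm h)\<^sup>2)"
      using exp[of h] quadratic_form_bound[OF M(2), of h] y by (simp add: h_def)
    also have "\<dots> \<le> (M + 1) * norm h * norm h"
      using M by (simp add: power2_eq_square algebra_simps)
    also have "\<dots> \<le> e * norm h"
      using y M by (intro mult_right_mono) (auto simp: h_def field_simps)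
    finally show "norm (\<phi> y - \<phi> x - (y - x) \<bullet> g) \<le> e * norm (y - x)"
      by (simp add: h_def inner_commute)
  qed
qed

lemma GDERIV_unique:
  fixes \<phi> :: "'a::real_inner \<Rightarrow> real"
  assumes "GDERIV \<phi> x :> g" "GDERIV \<phi> x :> g'"
  shows "g = g'"
proof -
  have "(\<lambda>h. h \<bullet> g) = (\<lambda>h. h \<bullet> g')"
    using assms unfolding gderiv_def by (rule has_derivative_unique)
  then have "(g - g') \<bullet> g = (g - g') \<bullet> g'"
    by (rule fun_cong)
  then have "(g - g') \<bullet> (g - g') = 0"
    by (simp add: inner_diff_right)
  then show ?thesis by simp
qed

lemma grad_eqI: "GDERIV (\<lambda>z. real_of_ereal (\<psi> z)) x :> g \<Longrightarrow> grad \<psi> x = g"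
  unfolding grad_def using GDERIV_unique by blast

text \<open>
  As the expansion entails differentiability at \<open>x\<close>, the gradient in it can only be
  \<^term>\<open>grad \<psi> x\<close>.
\<close>

lemma has_alexandrov_hessian_iff:
  "has_alexandrov_hessian \<psi> x A \<longleftrightarrow>
     transpose A = A \<and> second_order_expansion (\<lambda>z. real_of_ereal (\<psi> z)) x (grad \<psi> x) A"
    (is "?lhs \<longleftrightarrow> ?rhs")
proof -
  let ?\<phi> = "\<lambda>z. real_of_ereal (\<psi> z)"
  let ?r = "\<lambda>g h. ?\<phi> (x + h) - ?\<phi> x - g \<bullet> h - (1/2) * ((A *v h) \<bullet> h)"
  have key: "((\<lambda>h. ?r g h / (norm h)\<^sup>2) \<longlongrightarrow> 0) (at 0) \<longleftrightarrow> second_order_expansion ?\<phi> x g A" for g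
  proof
    assume lim: "((\<lambda>h. ?r g h / (norm h)\<^sup>2) \<longlongrightarrow> 0) (at 0)"
    show "second_order_expansion ?\<phi> x g A"
      unfolding second_order_expansion_def
    proof (intro allI impI)
      fix e :: real assume "e > 0"
      with lim obtain d where d: "d > 0"
        "\<And>h. h \<noteq> 0 \<Longrightarrow> norm h < d \<Longrightarrow> \<bar>?r g h / (norm h)\<^sup>2\<bar> < e"
        unfolding LIM_def by (force simp: dist_norm)
      have "\<bar>?r g h\<bar> \<le> e * (norm h)\<^sup>2" if "norm h \<le> d / 2" for h
      proof (cases "h = 0")
        case False
        then have "\<bar>?r g h\<bar> / (norm h)\<^sup>2 < e"
          using d(2)[of h] that d(1) by (simp add: abs_divide)
        then show ?thesis
          using False by (simp add: field_simps)
      qed simp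
      with d(1) show "\<exists>d>0. \<forall>h. norm h \<le> d \<longrightarrow> \<bar>?r g h\<bar> \<le> e * (norm h)\<^sup>2"
        by (intro exI[of _ "d/2"]) auto
    qed
  next
    assume exp: "second_order_expansion ?\<phi> x g A"
    show "((\<lambda>h. ?r g h / (norm h)\<^sup>2) \<longlongrightarrow> 0) (at 0)"
      unfolding LIM_def
    proof (intro allI impI)
      fix e :: real assume e: "e > 0"
      obtain d where d: "d > 0" "\<And>h. norm h \<le> d \<Longrightarrow> \<bar>?r g h\<bar> \<le> (e/2) * (norm h)\<^sup>2"
        using exp e unfolding second_order_expansion_def by (meson half_gt_zero)
      have "\<bar>?r g h / (norm h)\<^sup>2\<bar> < e" if "h \<noteq> 0" "norm h < d" for h
      proof -
        have "\<bar>?r g h\<bar> / (norm h)\<^sup>2 \<le> e / 2"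
          using d(2)[of h] that by (subst pos_divide_le_eq) auto
        also have "\<dots> < e"
          using e by simp
        finally show ?thesis
          by (simp add: abs_divide)
      qed
      with d(1) show "\<exists>s>0. \<forall>h. h \<noteq> 0 \<and> dist h 0 < s \<longrightarrow> dist (?r g h / (norm h)\<^sup>2) 0 < e"
        by (intro exI[of _ d]) (simp add: dist_norm)
    qed
  qed
  show ?thesis
    unfolding has_alexandrov_hessian_def key
    using second_order_expansion_imp_GDERIV grad_eqI by blast
qed

lemma second_order_expansion_unique:
  assumes A: "transpose A = A" "second_order_expansion \<phi> x g A"
    and B: "transpose B = B" "second_order_expansion \<phi> x g B"
  shows "A = B"
proof -
  define C where "C = A - B"
  have sym: "transpose C = C"
    using A B by (simp add: C_def transpose_def vec_eq_iff)
  have quad: "(C *v v) \<bullet> v = 0" for v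
  proof (rule ccontr)
    assume "(C *v v) \<bullet> v \<noteq> 0"
    define q where "q = \<bar>(C *v v) \<bullet> v\<bar>"
    have q: "q > 0" using \<open>(C *v v) \<bullet> v \<noteq> 0\<close> by (simp add: q_def)
    have v: "norm v > 0" using \<open>(C *v v) \<bullet> v \<noteq> 0\<close> by auto
    define e where "e = q / (8 * (norm v)\<^sup>2)"
    have e: "e > 0" using q v by (simp add: e_def)
    obtain d1 where d1: "d1 > 0" "\<And>h. norm h \<le> d1 \<Longrightarrow>
        \<bar>\<phi> (x + h) - \<phi> x - g \<bullet> h - (1/2) * ((A *v h) \<bullet> h)\<bar> \<le> e * (norm h)\<^sup>2"
      using A(2) e unfolding second_order_expansion_def by meson
    obtain d2 where d2: "d2 > 0" "\<And>h. norm h \<le> d2 \<Longrightarrow>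
        \<bar>\<phi> (x + h) - \<phi> x - g \<bullet> h - (1/2) * ((B *v h) \<bullet> h)\<bar> \<le> e * (norm h)\<^sup>2"
      using B(2) e unfolding second_order_expansion_def by meson
    define t where "t = min d1 d2 / norm v"
    have t: "t > 0" using d1 d2 v by (simp add: t_def)
    define h where "h = t *\<^sub>R v"
    have nh: "norm h = min d1 d2"
      using t v d1(1) d2(1) by (simp add: h_def t_def)
    have "(C *v h) \<bullet> h = (A *v h) \<bullet> h - (B *v h) \<bullet> h"
      by (simp add: C_def matrix_vector_mult_diff_rdistrib inner_diff_left)
    then have "\<bar>(C *v h) \<bullet> h\<bar> \<le> 4 * (e * (norm h)\<^sup>2)"
      using d1(2)[of h] d2(2)[of h] nh by linarith
    moreover have "\<bar>(C *v h) \<bullet> h\<bar> = t\<^sup>2 * q"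
      using t by (simp add: h_def q_def matrix_vector_mult_scaleR power2_eq_square abs_mult)
    moreover have "4 * (e * (norm h)\<^sup>2) = t\<^sup>2 * q / 2"
      using v t by (simp add: h_def e_def power_mult_distrib)
    ultimately show False
      using q t by simp
  qed
  \<comment> \<open>Polarization: the form is evaluated at \<open>u + C u\<close>.\<close>
  have "C *v u = 0" for u
  proof -
    have "(C *v (u + C *v u)) \<bullet> (u + C *v u)
        = (C *v u) \<bullet> u + 2 * ((C *v u) \<bullet> (C *v u)) + (C *v (C *v u)) \<bullet> (C *v u)"
      using inner_matrix_vector_symmetric[OF sym, of "C *v u" u]
      by (simp add: matrix_vector_right_distrib inner_add_left inner_add_right inner_commute)
    then have "(C *v u) \<bullet> (C *v u) = 0"
      unfolding quad by simp
    then show ?thesis by simp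
  qed
  then have "C = 0"
    by (simp add: matrix_eq)
  then show ?thesis by (simp add: C_def)
qed

lemma alexandrov_hessian_eqI:
  "has_alexandrov_hessian \<psi> x A \<Longrightarrow> alexandrov_hessian \<psi> x = A"
  unfolding alexandrov_hessian_def has_alexandrov_hessian_iff
  using second_order_expansion_unique by blast

lemma regular_pointsD:
  assumes "x \<in> regular_points \<psi>"
  shows "x \<in> int_dom \<psi>" "transpose (alexandrov_hessian \<psi> x) = alexandrov_hessian \<psi> x"
    "second_order_expansion (\<lambda>z. real_of_ereal (\<psi> z)) x (grad \<psi> x) (alexandrov_hessian \<psi> x)"
    "invertible (alexandrov_hessian \<psi> x)"
  using assms alexandrov_hessian_eqI unfolding regular_points_def has_alexandrov_hessian_iff
  by blast+

lemma regular_pointsI: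
  assumes "x \<in> int_dom \<psi>" "transpose A = A"
    and exp: "second_order_expansion (\<lambda>z. real_of_ereal (\<psi> z)) x g A"
    and "invertible A"
  shows "x \<in> regular_points \<psi>" "grad \<psi> x = g" "alexandrov_hessian \<psi> x = A"
proof -
  show g: "grad \<psi> x = g"
    using exp by (intro grad_eqI second_order_expansion_imp_GDERIV)
  then have A: "has_alexandrov_hessian \<psi> x A"
    using assms by (simp add: has_alexandrov_hessian_iff)
  then show "alexandrov_hessian \<psi> x = A"
    by (rule alexandrov_hessian_eqI)
  show "x \<in> regular_points \<psi>"
    using A assms by (auto simp: regular_points_def)
qed

section \<open>Subgradients of convex functions\<close>

lemma open_int_dom: "open (int_dom \<psi>)"
  by (simp add: int_dom_def)

lemma int_dom_finite:
  assumes "\<And>x. \<psi> x \<noteq> - \<infinity>" "x \<in> int_dom \<psi>"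
  shows "\<psi> x = ereal (real_of_ereal (\<psi> x))"
proof -
  have "\<psi> x < \<infinity>"
    using assms(2) interior_subset unfolding int_dom_def by blast
  then show ?thesis
    using assms(1)[of x] by (cases "\<psi> x") auto
qed

lemma convex_erealD:
  assumes "convex_ereal \<psi>" "\<psi> x = ereal r" "\<psi> z = ereal s" "0 \<le> t" "t \<le> 1"
  shows "\<psi> (x + t *\<^sub>R (z - x)) \<le> ereal (r + t * (s - r))"
proof -
  have "\<psi> ((1 - t) *\<^sub>R x + t *\<^sub>R z) \<le> ereal (1 - t) * \<psi> x + ereal t * \<psi> z"
    using assms(1,4,5) unfolding convex_ereal_def by (meson add.commute diff_add_cancel diff_ge_0_iff_ge)
  moreover have "(1 - t) *\<^sub>R x + t *\<^sub>R z = x + t *\<^sub>R (z - x)"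
    by (simp add: algebra_simps)
  ultimately show ?thesis
    using assms by (simp add: algebra_simps)
qed

text \<open>
  \<open>y\<close> is a subgradient of \<open>\<psi>\<close> at \<open>x\<close>. The real value of \<open>\<psi> x\<close> is used, so the notion is meant for
  points at which \<open>\<psi>\<close> is finite.
\<close>

definition subgradient :: "('a::real_inner \<Rightarrow> ereal) \<Rightarrow> 'a \<Rightarrow> 'a \<Rightarrow> bool" where
  "subgradient \<psi> x y \<longleftrightarrow> (\<forall>z. ereal (real_of_ereal (\<psi> x) + y \<bullet> (z - x)) \<le> \<psi> z)"

lemma GDERIV_imp_subgradient:
  fixes \<psi> :: "'a::real_inner \<Rightarrow> ereal"
  assumes nm: "\<And>x. \<psi> x \<noteq> - \<infinity>" and conv: "convex_ereal \<psi>" and x: "x \<in> int_dom \<psi>"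
    and deriv: "GDERIV (\<lambda>z. real_of_ereal (\<psi> z)) x :> g"
  shows "subgradient \<psi> x g"
  unfolding subgradient_def
proof
  fix z
  define r where "r = real_of_ereal (\<psi> x)"
  have r: "\<psi> x = ereal r"
    using int_dom_finite[of \<psi>, OF nm x] by (simp add: r_def)
  show "ereal (real_of_ereal (\<psi> x) + g \<bullet> (z - x)) \<le> \<psi> z"
  proof (cases "\<psi> z")
    case (real s)
    define f where "f t = real_of_ereal (\<psi> (x + t *\<^sub>R (z - x)))" for t
    have "((\<lambda>t. x + t *\<^sub>R (z - x)) has_derivative (\<lambda>t. t *\<^sub>R (z - x))) (at 0)"
      by (auto intro!: derivative_eq_intros)
    moreover have "((\<lambda>z. real_of_ereal (\<psi> z)) has_derivative (\<lambda>h. h \<bullet> g)) (at (x + 0 *\<^sub>R (z - x)))"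
      using deriv by (simp add: gderiv_def)
    ultimately have "(f has_derivative (\<lambda>t. (t *\<^sub>R (z - x)) \<bullet> g)) (at 0)"
      unfolding f_def by (rule has_derivative_compose)
    then have "DERIV f 0 :> (g \<bullet> (z - x))"
      by (simp add: has_field_derivative_def inner_commute mult_commute_abs)
    then have lim: "((\<lambda>t. (f t - f 0) / t) \<longlongrightarrow> g \<bullet> (z - x)) (at_right 0)"
      by (auto simp: DERIV_def intro: tendsto_within_subset)
    have "eventually (\<lambda>t. (f t - f 0) / t \<le> s - r) (at_right 0)"
    proof (rule eventually_at_rightI)
      fix t :: real assume t: "t \<in> {0<..<1}"
      have le: "\<psi> (x + t *\<^sub>R (z - x)) \<le> ereal (r + t * (s - r))"
        using t by (intro convex_erealD[OF conv r real]) auto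
      then have "f t \<le> r + t * (s - r)"
        using nm[of "x + t *\<^sub>R (z - x)"] unfolding f_def
        by (cases "\<psi> (x + t *\<^sub>R (z - x))") auto
      moreover have "f 0 = r"
        by (simp add: f_def r_def)
      ultimately show "(f t - f 0) / t \<le> s - r"
        using t by (simp add: field_simps)
    qed simp
    then have "g \<bullet> (z - x) \<le> s - r"
      by (intro tendsto_upperbound[OF lim]) simp_all
    then show ?thesis
      using real by (simp add: r_def)
  qed (use nm in auto)
qed

text \<open>
  Equality in Young's inequality \<open>\<langle>x, y\<rangle> \<le> \<psi>(x) + \<psi>\<^sup>*(y)\<close>.
\<close>

lemma legendre_at_subgradient:
  assumes "\<psi> x = ereal r" "subgradient \<psi> x y"
  shows "legendre \<psi> y = ereal (x \<bullet> y - r)"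
proof (rule antisym)
  show "legendre \<psi> y \<le> ereal (x \<bullet> y - r)"
    unfolding legendre_def
  proof (rule SUP_least)
    fix z
    have "ereal (r + y \<bullet> (z - x)) \<le> \<psi> z"
      using assms by (metis subgradient_def real_of_ereal.simps(1))
    then show "ereal (z \<bullet> y) - \<psi> z \<le> ereal (x \<bullet> y - r)"
      by (cases "\<psi> z") (auto simp: inner_diff_right inner_commute)
  qed
  show "ereal (x \<bullet> y - r) \<le> legendre \<psi> y"
    unfolding legendre_def by (rule SUP_upper2[of x]) (simp_all add: assms)
qed

text \<open>
  Near an interior point of the domain, the expansion and the subgradient inequality hold for
  finite values of \<open>\<psi>\<close>.
\<close>

lemma expansion_near:
  fixes \<psi> :: "real^'n \<Rightarrow> ereal"
  assumes nm: "\<And>x. \<psi> x \<noteq> - \<infinity>" and x: "x \<in> int_dom \<psi>" and r: "\<psi> x = ereal r"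
    and sub: "subgradient \<psi> x y"
    and exp: "second_order_expansion (\<lambda>z. real_of_ereal (\<psi> z)) x y A" and e: "e > 0"
  obtains d where "d > 0"
    "\<And>h. norm h \<le> d \<Longrightarrow> \<exists>s. \<psi> (x + h) = ereal s \<and> r + y \<bullet> h \<le> s \<and>
       \<bar>s - r - y \<bullet> h - (1/2) * ((A *v h) \<bullet> h)\<bar> \<le> e * (norm h)\<^sup>2"
proof -
  obtain d1 where d1: "d1 > 0" "cball x d1 \<subseteq> int_dom \<psi>"
    using open_int_dom x open_contains_cball by blast
  obtain d2 where d2: "d2 > 0" "\<And>h. norm h \<le> d2 \<Longrightarrow>
      \<bar>real_of_ereal (\<psi> (x + h)) - r - y \<bullet> h - (1/2) * ((A *v h) \<bullet> h)\<bar> \<le> e * (norm h)\<^sup>2"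
    using exp e r unfolding second_order_expansion_def by (metis real_of_ereal.simps(1))
  have "\<exists>s. \<psi> (x + h) = ereal s \<and> r + y \<bullet> h \<le> s \<and>
       \<bar>s - r - y \<bullet> h - (1/2) * ((A *v h) \<bullet> h)\<bar> \<le> e * (norm h)\<^sup>2" if h: "norm h \<le> min d1 d2" for h
  proof -
    have "x + h \<in> int_dom \<psi>"
      using d1(2) h by (auto simp: dist_norm)
    then have eq: "\<psi> (x + h) = ereal (real_of_ereal (\<psi> (x + h)))"
      by (rule int_dom_finite[of \<psi>, OF nm])
    have "ereal (r + y \<bullet> h) \<le> \<psi> (x + h)"
      using sub r unfolding subgradient_def by (metis add_diff_cancel_left' real_of_ereal.simps(1))
    with eq d2(2)[of h] h show ?thesis
      by (metis ereal_less_eq(3) min.boundedE)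
  qed
  then show thesis
    using d1(1) d2(1) that[of "min d1 d2"] by simp
qed

lemma expansion_imp_positive_semidefinite:
  fixes \<psi> :: "real^'n \<Rightarrow> ereal"
  assumes nm: "\<And>x. \<psi> x \<noteq> - \<infinity>" and x: "x \<in> int_dom \<psi>"
    and sub: "subgradient \<psi> x y"
    and exp: "second_order_expansion (\<lambda>z. real_of_ereal (\<psi> z)) x y A"
  shows "0 \<le> (A *v v) \<bullet> v"
proof (rule ccontr)
  assume "\<not> 0 \<le> (A *v v) \<bullet> v"
  define q where "q = - ((A *v v) \<bullet> v)"
  have q: "q > 0" and v: "norm v > 0"
    using \<open>\<not> 0 \<le> (A *v v) \<bullet> v\<close> by (auto simp: q_def)
  have r: "\<psi> x = ereal (real_of_ereal (\<psi> x))"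
    by (rule int_dom_finite[of \<psi>, OF nm x])
  have "q / (4 * (norm v)\<^sup>2) > 0"
    using q v by simp
  then obtain d where d: "d > 0" and near: "\<And>h. norm h \<le> d \<Longrightarrow> \<exists>s. \<psi> (x + h) = ereal s \<and>
       real_of_ereal (\<psi> x) + y \<bullet> h \<le> s \<and>
       \<bar>s - real_of_ereal (\<psi> x) - y \<bullet> h - (1/2) * ((A *v h) \<bullet> h)\<bar> \<le> q / (4 * (norm v)\<^sup>2) * (norm h)\<^sup>2"
    using expansion_near[of \<psi>, OF nm x r sub exp] by metis
  define t where "t = d / norm v"
  have t: "t > 0" and nt: "norm (t *\<^sub>R v) = d"
    using d v by (auto simp: t_def)
  have "- (1/2) * ((A *v (t *\<^sub>R v)) \<bullet> (t *\<^sub>R v)) \<le> q / (4 * (norm v)\<^sup>2) * (norm (t *\<^sub>R v))\<^sup>2"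
    using near[of "t *\<^sub>R v"] nt by force
  also have "\<dots> = t\<^sup>2 * q / 4"
    using v by (simp add: power_mult_distrib)
  also have "- (1/2) * ((A *v (t *\<^sub>R v)) \<bullet> (t *\<^sub>R v)) = t\<^sup>2 * q / 2"
    by (simp add: q_def matrix_vector_mult_scaleR power2_eq_square)
  finally show False
    using q t by simp
qed

text \<open>
  A symmetric invertible positive semidefinite matrix is positive definite, with a uniform lower
  bound by compactness of the sphere.
\<close>

lemma positive_semidefinite_invertible_imp_coercive:
  fixes A :: "real^'n^'n"
  assumes sym: "transpose A = A" and inv: "invertible A" and psd: "\<And>v. 0 \<le> (A *v v) \<bullet> v"
  obtains c where "c > 0" "\<And>v. c * (norm v)\<^sup>2 \<le> (A *v v) \<bullet> v"
proof -
  have pos: "(A *v v) \<bullet> v > 0" if "v \<noteq> 0" for v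
  proof (rule ccontr)
    assume "\<not> (A *v v) \<bullet> v > 0"
    then have 0: "(A *v v) \<bullet> v = 0" using psd[of v] by simp
    define p where "p = A *v v"
    have p: "p \<noteq> 0"
    proof
      assume "p = 0"
      obtain B where "B ** A = mat 1" using inv invertible_left_inverse by blast
      then have "v = B *v p"
        by (simp add: p_def matrix_vector_mul_assoc)
      with \<open>p = 0\<close> \<open>v \<noteq> 0\<close> show False by simp
    qed
    define Q where "Q = (A *v p) \<bullet> p"
    \<comment> \<open>At \<open>v - t A v\<close> with small \<open>t > 0\<close> the form would be negative.\<close>
    have quad: "0 \<le> - 2 * t * (p \<bullet> p) + t\<^sup>2 * Q" for t
    proof -
      have "(A *v (v - t *\<^sub>R p)) \<bullet> (v - t *\<^sub>R p)
          = (A *v v) \<bullet> v - t * ((A *v v) \<bullet> p) - t * ((A *v p) \<bullet> v) + t * (t * Q)"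
        by (simp add: Q_def matrix_vector_mult_diff_distrib matrix_vector_mult_scaleR
            inner_diff_left inner_diff_right algebra_simps)
      also have "(A *v p) \<bullet> v = p \<bullet> p"
        using inner_matrix_vector_symmetric[OF sym, of p v] by (simp add: p_def)
      finally show ?thesis
        using psd[of "v - t *\<^sub>R p"] 0 by (simp add: p_def power2_eq_square algebra_simps)
    qed
    have Q: "Q \<ge> 0" unfolding Q_def by (rule psd)
    have pp: "p \<bullet> p > 0" using p by simp
    define t where "t = (p \<bullet> p) / (Q + 1)"
    have t: "t > 0" using pp Q by (simp add: t_def)
    have "t * Q \<le> p \<bullet> p"
      using Q pp by (simp add: t_def field_simps)
    then have "t * (t * Q) \<le> t * (p \<bullet> p)"
      using t by (intro mult_left_mono) auto
    moreover have "t * (p \<bullet> p) > 0"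
      using t pp by simp
    ultimately show False
      using quad[of t] by (simp add: power2_eq_square)
  qed
  have "compact (sphere (0::real^'n) 1)" "sphere (0::real^'n) 1 \<noteq> {}"
    by auto
  moreover have "continuous_on (sphere 0 1) (\<lambda>v. (A *v v) \<bullet> v)"
    by (intro continuous_intros linear_continuous_on matrix_vector_mul_bounded_linear)
  ultimately obtain u where u: "u \<in> sphere 0 1" "\<And>v. v \<in> sphere 0 1 \<Longrightarrow> (A *v u) \<bullet> u \<le> (A *v v) \<bullet> v"
    using continuous_attains_inf by (metis (no_types, lifting))
  show thesis
  proof (rule that[of "(A *v u) \<bullet> u"])
    show "(A *v u) \<bullet> u > 0"
      using u(1) by (intro pos) auto
    fix v :: "real^'n"
    show "(A *v u) \<bullet> u * (norm v)\<^sup>2 \<le> (A *v v) \<bullet> v"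
    proof (cases "v = 0")
      case False
      define w where "w = v /\<^sub>R norm v"
      have "(A *v u) \<bullet> u \<le> (A *v w) \<bullet> w"
        using False by (intro u(2)) (simp add: w_def)
      moreover have "(A *v v) \<bullet> v = (norm v)\<^sup>2 * ((A *v w) \<bullet> w)"
        using False by (simp add: w_def matrix_vector_mult_scaleR power2_eq_square field_simps)
      ultimately show ?thesis
        using False by (simp add: mult.commute mult_left_mono)
    qed simp
  qed
qed

text \<open>
  The determinant does not vanish on the segment from the identity matrix to \<open>A\<close>.
\<close>

lemma det_pos_if_coercive:
  fixes A :: "real^'n^'n"
  assumes c: "c > 0" and coercive: "\<And>v. c * (norm v)\<^sup>2 \<le> (A *v v) \<bullet> v"
  shows "det A > 0"
proof (rule ccontr)
  assume neg: "\<not> det A > 0"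
  define P where "P t = t *\<^sub>R A + (1 - t) *\<^sub>R mat 1" for t :: real
  have "continuous_on {0..1} (\<lambda>t. det (P t))"
    unfolding det_def P_def by (intro continuous_intros)
  moreover have "det (P 0) = 1" "det (P 1) = det A"
    by (simp_all add: P_def)
  ultimately obtain t where t: "0 \<le> t" "t \<le> 1" "det (P t) = 0"
    using IVT2'[of "\<lambda>t. det (P t)" 1 0 0] neg by auto
  then have "\<not> invertible (P t)"
    by (simp add: invertible_det_nz)
  then obtain v where v: "P t *v v = 0" "v \<noteq> 0"
    using invertible_left_inverse matrix_left_invertible_ker by blast
  have "(P t *v v) \<bullet> v = t * ((A *v v) \<bullet> v) + (1 - t) * (norm v)\<^sup>2"
    by (simp add: P_def matrix_vector_mult_add_rdistrib scaleR_matrix_vector_assoc[symmetric]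
        inner_add_left power2_norm_eq_inner)
  also have "\<dots> \<ge> t * (c * (norm v)\<^sup>2) + (1 - t) * (norm v)\<^sup>2"
    using t coercive[of v] by (intro add_right_mono mult_left_mono) auto
  also have "t * (c * (norm v)\<^sup>2) + (1 - t) * (norm v)\<^sup>2 = (t * c + (1 - t)) * (norm v)\<^sup>2"
    by (simp add: algebra_simps)
  finally have "(t * c + (1 - t)) * (norm v)\<^sup>2 \<le> 0"
    using v by simp
  moreover have "t * c + (1 - t) > 0"
    using t c by (cases "t = 0") (auto intro: add_pos_nonneg)
  ultimately show False
    using v by (simp add: mult_le_0_iff)
qed

section \<open>Legendre transform and gradient near a regular point\<close>

text \<open>
  The Legendre transform of \<open>f(h) = \<psi>(x + h) - \<psi>(x) - \<langle>y, h\<rangle>\<close> is, up to \<open>o(|k|\<^sup>2)\<close>, that of the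
  quadratic form \<open>1/2 \<langle>A h, h\<rangle>\<close>, namely \<open>1/2 \<langle>A\<^sup>-\<^sup>1 k, k\<rangle>\<close>. For small \<open>h\<close> this is the expansion of
  \<open>\<psi>\<close>; for large \<open>h\<close> convexity makes \<open>f\<close> grow at least linearly, so that such \<open>h\<close> do not
  contribute to the supremum when \<open>k\<close> is small. It is part of the conclusion that \<open>\<psi>\<^sup>*\<close> is finite
  near \<open>y\<close>.
\<close>

lemma legendre_expansion_bound:
  fixes \<psi> :: "real^'n \<Rightarrow> ereal"
  assumes nm: "\<And>x. \<psi> x \<noteq> - \<infinity>" and conv: "convex_ereal \<psi>"
    and x: "x \<in> int_dom \<psi>" and r: "\<psi> x = ereal r" and sub: "subgradient \<psi> x y"
    and sym: "transpose A = A" and AB: "A ** B = mat 1"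
    and exp: "second_order_expansion (\<lambda>z. real_of_ereal (\<psi> z)) x y A" and e: "e > 0"
  obtains d where "d > 0"
    "\<And>k. norm k \<le> d \<Longrightarrow> \<exists>s. legendre \<psi> (y + k) = ereal s \<and>
       \<bar>s - (x \<bullet> y - r) - x \<bullet> k - (1/2) * ((B *v k) \<bullet> k)\<bar> \<le> e * (norm k)\<^sup>2"
proof -
  have inv: "invertible A"
    using AB invertible_right_inverse by blast
  obtain c where c: "c > 0" and coer: "\<And>v. c * (norm v)\<^sup>2 \<le> (A *v v) \<bullet> v"
    using positive_semidefinite_invertible_imp_coercive[OF sym inv
        expansion_imp_positive_semidefinite[of \<psi>, OF nm x sub exp]] by metis
  obtain M where M: "M > 0" and B: "\<And>k. norm (B *v k) \<le> M * norm k"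
    using matrix_vector_mult_bound[of B] by metis
  have AB': "A *v (B *v k) = k" for k
    by (simp add: matrix_vector_mul_assoc AB)
  define \<epsilon> where "\<epsilon> = min (c / 4) (e / (2 * M\<^sup>2))"
  have \<epsilon>: "\<epsilon> > 0" "\<epsilon> \<le> c / 4" "2 * \<epsilon> * M\<^sup>2 \<le> e"
    using c e M by (auto simp: \<epsilon>_def min_def field_simps)
  obtain d0 where d0: "d0 > 0" and near: "\<And>h. norm h \<le> d0 \<Longrightarrow> \<exists>s. \<psi> (x + h) = ereal s \<and>
       r + y \<bullet> h \<le> s \<and> \<bar>s - r - y \<bullet> h - (1/2) * ((A *v h) \<bullet> h)\<bar> \<le> \<epsilon> * (norm h)\<^sup>2"
    using expansion_near[of \<psi>, OF nm x r sub exp \<epsilon>(1)] by metis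
  define d where "d = min (d0 / M) (c * d0 / 4)"
  have d: "d > 0"
    using d0 M c by (simp add: d_def)
  define Q where "Q k = (1/2) * ((B *v k) \<bullet> k)" for k
  have Q_nonneg: "Q k \<ge> 0" for k
  proof -
    have "0 \<le> c * (norm (B *v k))\<^sup>2" using c by simp
    also have "\<dots> \<le> (B *v k) \<bullet> k"
      using coer[of "B *v k"] by (simp add: AB' inner_commute)
    finally show ?thesis by (simp add: Q_def)
  qed
  have B2: "(norm (B *v k))\<^sup>2 \<le> M\<^sup>2 * (norm k)\<^sup>2" for k
    using power_mono[OF B[of k], of 2] by (simp add: power_mult_distrib)
  have upper: "h \<bullet> k - (s - r - y \<bullet> h) \<le> Q k + e * (norm k)\<^sup>2"
    if s: "\<psi> (x + h) = ereal s" and k: "norm k \<le> d" for h k s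
  proof (cases "norm h \<le> d0")
    case True
    \<comment> \<open>Completing the square: \<open>B k\<close> maximizes \<open>\<langle>h, k\<rangle> - 1/2 \<langle>A h, h\<rangle>\<close> over \<open>h\<close>.\<close>
    define w where "w = h - B *v k"
    have "c * (norm w)\<^sup>2 \<le> (A *v w) \<bullet> w"
      by (rule coer)
    also have "\<dots> = (A *v h) \<bullet> h - 2 * (h \<bullet> k) + 2 * Q k"
      using inner_matrix_vector_symmetric[OF sym, of h "B *v k"]
      by (simp add: w_def Q_def matrix_vector_mult_diff_distrib AB' inner_diff_left inner_diff_right
          inner_commute)
    finally have 1: "h \<bullet> k - (1/2) * ((A *v h) \<bullet> h) \<le> Q k - (c / 2) * (norm w)\<^sup>2"
      by simp
    have 2: "s - r - y \<bullet> h \<ge> (1/2) * ((A *v h) \<bullet> h) - \<epsilon> * (norm h)\<^sup>2"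
      using near[OF True] s by force
    have "norm h \<le> norm w + norm (B *v k)"
      using norm_triangle_ineq[of w "B *v k"] by (simp add: w_def)
    then have "(norm h)\<^sup>2 \<le> (norm w + norm (B *v k))\<^sup>2"
      by (simp add: power_mono)
    also have "\<dots> \<le> 2 * (norm w)\<^sup>2 + 2 * (norm (B *v k))\<^sup>2"
      using sum_squares_ge_zero[of "norm w - norm (B *v k)" 0]
      by (simp add: power2_eq_square algebra_simps)
    also have "\<dots> \<le> 2 * (norm w)\<^sup>2 + 2 * (M\<^sup>2 * (norm k)\<^sup>2)"
      using B2[of k] by simp
    finally have "\<epsilon> * (norm h)\<^sup>2 \<le> \<epsilon> * (2 * (norm w)\<^sup>2 + 2 * (M\<^sup>2 * (norm k)\<^sup>2))"
      using \<epsilon>(1) by (intro mult_left_mono) auto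
    also have "\<dots> = 2 * \<epsilon> * (norm w)\<^sup>2 + (2 * \<epsilon> * M\<^sup>2) * (norm k)\<^sup>2"
      by (simp add: algebra_simps)
    also have "\<dots> \<le> (c / 2) * (norm w)\<^sup>2 + e * (norm k)\<^sup>2"
      using \<epsilon> by (intro add_mono mult_right_mono) auto
    finally show ?thesis
      using 1 2 by linarith
  next
    case False
    \<comment> \<open>The point \<open>t h\<close> lies on the sphere of radius \<open>d0\<close>, where the expansion still applies.\<close>
    define t where "t = d0 / norm h"
    have h: "norm h > 0"
      using False d0 by linarith
    then have t: "0 < t" "t \<le> 1"
      using False d0 by (auto simp: t_def)
    have nth: "norm (t *\<^sub>R h) = d0"
      using h d0 by (simp add: t_def)
    obtain s' where s': "\<psi> (x + t *\<^sub>R h) = ereal s'"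
      "\<bar>s' - r - y \<bullet> (t *\<^sub>R h) - (1/2) * ((A *v (t *\<^sub>R h)) \<bullet> (t *\<^sub>R h))\<bar> \<le> \<epsilon> * (norm (t *\<^sub>R h))\<^sup>2"
      using near[of "t *\<^sub>R h"] nth by auto
    have "\<psi> (x + t *\<^sub>R ((x + h) - x)) \<le> ereal (r + t * (s - r))"
      using t by (intro convex_erealD[OF conv r s]) auto
    then have le: "s' - r \<le> t * (s - r)"
      using s' by simp
    have "(c / 4) * d0\<^sup>2 \<le> (c / 2 - \<epsilon>) * (norm (t *\<^sub>R h))\<^sup>2"
      unfolding nth using \<epsilon> by (intro mult_right_mono) auto
    also have "\<dots> \<le> s' - r - y \<bullet> (t *\<^sub>R h)"
      using s'(2) coer[of "t *\<^sub>R h"] by (simp add: algebra_simps)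
    also have "\<dots> \<le> t * (s - r - y \<bullet> h)"
      using le by (simp add: algebra_simps)
    also have "(c / 4) * d0\<^sup>2 = (c * d0 / 4) * (t * norm h)"
      using h by (simp add: t_def power2_eq_square)
    finally have "t * ((c * d0 / 4) * norm h) \<le> t * (s - r - y \<bullet> h)"
      by (simp only: mult.left_commute)
    then have "(c * d0 / 4) * norm h \<le> s - r - y \<bullet> h"
      using t by simp
    moreover have "h \<bullet> k \<le> (c * d0 / 4) * norm h"
    proof -
      have "h \<bullet> k \<le> norm h * norm k" by (rule norm_cauchy_schwarz)
      also have "\<dots> \<le> norm h * (c * d0 / 4)"
        using k by (intro mult_left_mono) (auto simp: d_def)
      finally show ?thesis by (simp add: mult.commute)
    qed
    ultimately show ?thesis
      using Q_nonneg[of k] mult_nonneg_nonneg[OF less_imp_le[OF e] zero_le_power2[of "norm k"]]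
      by linarith
  qed
  have "\<exists>s. legendre \<psi> (y + k) = ereal s \<and>
       \<bar>s - (x \<bullet> y - r) - x \<bullet> k - (1/2) * ((B *v k) \<bullet> k)\<bar> \<le> e * (norm k)\<^sup>2" if k: "norm k \<le> d" for k
  proof -
    define b where "b = x \<bullet> y - r + x \<bullet> k + Q k"
    have up: "legendre \<psi> (y + k) \<le> ereal (b + e * (norm k)\<^sup>2)"
      unfolding legendre_def
    proof (rule SUP_least)
      fix z
      show "ereal (z \<bullet> (y + k)) - \<psi> z \<le> ereal (b + e * (norm k)\<^sup>2)"
      proof (cases "\<psi> z")
        case (real s)
        then have "\<psi> (x + (z - x)) = ereal s" by simp
        from upper[OF this k] show ?thesis
          using real by (simp add: b_def inner_diff_left inner_diff_right inner_add_right inner_commute)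
      qed (use nm in auto)
    qed
    \<comment> \<open>Lower bound: the near-maximizer \<open>h = B k\<close> is inserted into the supremum.\<close>
    have "norm (B *v k) \<le> M * norm k" by (rule B)
    also have "\<dots> \<le> d0"
      using k M by (simp add: d_def field_simps)
    finally have nBk: "norm (B *v k) \<le> d0" .
    then obtain s where s: "\<psi> (x + B *v k) = ereal s"
      "\<bar>s - r - y \<bullet> (B *v k) - (1/2) * ((A *v (B *v k)) \<bullet> (B *v k))\<bar> \<le> \<epsilon> * (norm (B *v k))\<^sup>2"
      using near by blast
    have "\<epsilon> * (norm (B *v k))\<^sup>2 \<le> \<epsilon> * (M\<^sup>2 * (norm k)\<^sup>2)"
      using \<epsilon>(1) B2 by (intro mult_left_mono) auto
    also have "\<dots> = (\<epsilon> * M\<^sup>2) * (norm k)\<^sup>2" by simp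
    also have "\<dots> \<le> e * (norm k)\<^sup>2"
    proof (rule mult_right_mono)
      show "\<epsilon> * M\<^sup>2 \<le> e"
        using \<epsilon>(3) mult_nonneg_nonneg[OF less_imp_le[OF \<epsilon>(1)] zero_le_power2[of M]] by linarith
    qed simp
    finally have "b - e * (norm k)\<^sup>2 \<le> (x + B *v k) \<bullet> (y + k) - s"
      using s(2) by (simp add: b_def Q_def AB' inner_add_left inner_add_right inner_commute)
    then have "ereal (b - e * (norm k)\<^sup>2) \<le> ereal ((x + B *v k) \<bullet> (y + k)) - \<psi> (x + B *v k)"
      by (simp add: s)
    also have "\<dots> \<le> legendre \<psi> (y + k)"
      unfolding legendre_def by (rule SUP_upper) simp
    finally have low: "ereal (b - e * (norm k)\<^sup>2) \<le> legendre \<psi> (y + k)" .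
    show ?thesis
      using up low by (cases "legendre \<psi> (y + k)") (auto simp: b_def Q_def abs_le_iff)
  qed
  with d show thesis by (rule that)
qed

text \<open>
  A second order expansion at \<open>x\<close> makes every selection of subgradients differentiable at \<open>x\<close>.
  The subgradient inequality at \<open>x + h\<close> is tested with a step \<open>w\<close> of length \<open>t |h|\<close> in the direction
  of the error \<open>k - A h\<close>; both ends are controlled by the expansion with error \<open>t\<^sup>2 |h|\<^sup>2\<close>, which
  gives \<open>|k - A h| \<le> t (M/2 + 5) |h|\<close>, where \<open>M\<close> bounds the norm of \<open>A\<close>.
\<close>

lemma subgradient_near_expansion:
  fixes \<psi> :: "real^'n \<Rightarrow> ereal"
  assumes nm: "\<And>x. \<psi> x \<noteq> - \<infinity>" and x: "x \<in> int_dom \<psi>" and sub: "subgradient \<psi> x y"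
    and sym: "transpose A = A"
    and exp: "second_order_expansion (\<lambda>z. real_of_ereal (\<psi> z)) x y A" and e: "e > 0"
  obtains d where "d > 0"
    "\<And>h k. 0 < norm h \<Longrightarrow> norm h < d \<Longrightarrow> subgradient \<psi> (x + h) (y + k) \<Longrightarrow>
       norm (k - A *v h) \<le> e * norm h"
proof -
  define r where "r = real_of_ereal (\<psi> x)"
  have r: "\<psi> x = ereal r"
    using int_dom_finite[of \<psi>, OF nm x] by (simp add: r_def)
  obtain M where M: "M > 0" and A: "\<And>h. norm (A *v h) \<le> M * norm h"
    using matrix_vector_mult_bound[of A] by metis
  define t where "t = min 1 (e / (M / 2 + 5))"
  have t: "0 < t" "t \<le> 1" "t \<le> e / (M / 2 + 5)"
    using M e by (auto simp: t_def)
  then have t': "t * (M / 2 + 5) \<le> e"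
    using M by (subst (asm) pos_le_divide_eq) auto
  obtain d0 where d0: "d0 > 0" and near: "\<And>h. norm h \<le> d0 \<Longrightarrow> \<exists>s. \<psi> (x + h) = ereal s \<and>
       r + y \<bullet> h \<le> s \<and> \<bar>s - r - y \<bullet> h - (1/2) * ((A *v h) \<bullet> h)\<bar> \<le> t\<^sup>2 * (norm h)\<^sup>2"
    using expansion_near[of \<psi>, OF nm x r sub exp, of "t\<^sup>2"] t(1) by (metis zero_less_power)
  have "norm (k - A *v h) \<le> e * norm h"
    if h: "0 < norm h" "norm h < d0 / 2" and subh: "subgradient \<psi> (x + h) (y + k)" for h k
  proof (cases "k - A *v h = 0")
    case False
    define p where "p = k - A *v h"
    have p: "norm p > 0" using False by (simp add: p_def)
    define w where "w = (t * norm h / norm p) *\<^sub>R p"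
    have nw: "norm w = t * norm h"
      using t p by (simp add: w_def)
    have nw': "norm w \<le> norm h"
      unfolding nw using t h(1) by (simp add: mult_left_le_one_le)
    have hw: "norm (h + w) \<le> 2 * norm h"
      using norm_triangle_ineq[of h w] nw' by simp
    obtain s where s: "\<psi> (x + h) = ereal s"
      "\<bar>s - r - y \<bullet> h - (1/2) * ((A *v h) \<bullet> h)\<bar> \<le> t\<^sup>2 * (norm h)\<^sup>2"
      using near[of h] h by auto
    obtain s' where s': "\<psi> (x + (h + w)) = ereal s'"
      "\<bar>s' - r - y \<bullet> (h + w) - (1/2) * ((A *v (h + w)) \<bullet> (h + w))\<bar> \<le> t\<^sup>2 * (norm (h + w))\<^sup>2"
      using near[of "h + w"] hw h(2) by auto
    have "ereal (s + (y + k) \<bullet> ((x + (h + w)) - (x + h))) \<le> \<psi> (x + (h + w))"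
      using subh s(1) unfolding subgradient_def by (metis real_of_ereal.simps(1))
    then have 1: "s + (y + k) \<bullet> w \<le> s'"
      by (simp add: s')
    have sq: "(norm (h + w))\<^sup>2 \<le> 4 * (norm h)\<^sup>2"
      using power_mono[OF hw, of 2] by (simp add: power_mult_distrib)
    have 2: "t\<^sup>2 * (norm (h + w))\<^sup>2 \<le> 4 * (t\<^sup>2 * (norm h)\<^sup>2)"
      using mult_left_mono[OF sq, of "t\<^sup>2"] by simp
    have 3: "(A *v (h + w)) \<bullet> (h + w) = (A *v h) \<bullet> h + (A *v h) \<bullet> w + (A *v w) \<bullet> h + (A *v w) \<bullet> w"
      by (simp add: matrix_vector_right_distrib inner_add_left inner_add_right)
    have 4: "(A *v w) \<bullet> w \<le> M * (t\<^sup>2 * (norm h)\<^sup>2)"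
      using quadratic_form_bound[OF A, of w] by (simp add: nw power_mult_distrib)
    have 5: "(A *v w) \<bullet> h = (A *v h) \<bullet> w"
      by (rule inner_matrix_vector_symmetric[OF sym])
    have 6: "s' \<le> r + y \<bullet> h + y \<bullet> w
        + ((A *v h) \<bullet> h + 2 * ((A *v h) \<bullet> w) + (A *v w) \<bullet> w) / 2 + 4 * (t\<^sup>2 * (norm h)\<^sup>2)"
      using order_trans[OF abs_ge_self s'(2)] 2 unfolding 3 5 inner_add_right[of y h w]
      by (simp add: algebra_simps add_divide_distrib)
    have 7: "r + y \<bullet> h + ((A *v h) \<bullet> h) / 2 - t\<^sup>2 * (norm h)\<^sup>2 \<le> s"
      using s(2) by linarith
    have 8: "s + y \<bullet> w + k \<bullet> w \<le> s'"
      using 1 by (simp add: inner_add_left)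
    have "p \<bullet> w = k \<bullet> w - (A *v h) \<bullet> w"
      by (simp add: p_def inner_diff_left)
    also have "\<dots> \<le> (M * (t\<^sup>2 * (norm h)\<^sup>2)) / 2 + 5 * (t\<^sup>2 * (norm h)\<^sup>2)"
      using 4 6 7 8 by (simp add: add_divide_distrib)
    also have "\<dots> = (t * norm h) * (t * (M / 2 + 5) * norm h)"
      by (simp add: power2_eq_square algebra_simps)
    also have "\<dots> \<le> (t * norm h) * (e * norm h)"
      using t t' h by (intro mult_left_mono mult_right_mono) auto
    also have "p \<bullet> w = (t * norm h) * norm p"
      using p by (simp add: w_def power2_norm_eq_inner[symmetric] power2_eq_square)
    finally show ?thesis
      using t h(1) by (simp add: p_def)
  qed (use e in simp)
  then show thesis
    using that[of "d0 / 2"] d0 by simp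
qed

section \<open>The biconjugate function\<close>

lemma legendre_upper: "ereal (x \<bullet> y) - \<psi> x \<le> legendre \<psi> y"
  unfolding legendre_def by (rule SUP_upper) simp

lemma legendre_not_minf:
  assumes "\<psi> x = ereal r"
  shows "legendre \<psi> y \<noteq> - \<infinity>"
  using legendre_upper[of x y \<psi>] assms by auto

lemma convex_ereal_legendre:
  assumes nm: "\<And>x. \<psi> x \<noteq> - \<infinity>"
  shows "convex_ereal (legendre \<psi>)"
  unfolding convex_ereal_def
proof (intro allI impI)
  fix y z and u v :: real
  assume uv: "0 \<le> u" "0 \<le> v" "u + v = 1"
  show "legendre \<psi> (u *\<^sub>R y + v *\<^sub>R z) \<le> ereal u * legendre \<psi> y + ereal v * legendre \<psi> z"
    unfolding legendre_def[of \<psi> "u *\<^sub>R y + v *\<^sub>R z"]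
  proof (rule SUP_least)
    fix x
    show "ereal (x \<bullet> (u *\<^sub>R y + v *\<^sub>R z)) - \<psi> x \<le> ereal u * legendre \<psi> y + ereal v * legendre \<psi> z"
    proof (cases "\<psi> x")
      case (real r)
      have "ereal (x \<bullet> (u *\<^sub>R y + v *\<^sub>R z)) - \<psi> x = ereal (u * (x \<bullet> y - r) + v * (x \<bullet> z - r))"
      proof -
        have "r = u * r + v * r"
          using uv(3) by (metis distrib_right mult_1)
        then show ?thesis
          by (simp add: real inner_add_right algebra_simps)
      qed
      also have "\<dots> = ereal u * (ereal (x \<bullet> y) - \<psi> x) + ereal v * (ereal (x \<bullet> z) - \<psi> x)"
        by (simp add: real)
      also have "\<dots> \<le> ereal u * legendre \<psi> y + ereal v * legendre \<psi> z"
        using uv by (intro add_mono ereal_mult_left_mono legendre_upper) auto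
      finally show ?thesis .
    qed (use nm in auto)
  qed
qed

lemma biconjugate_le:
  assumes nm: "\<And>x. \<psi> x \<noteq> - \<infinity>"
  shows "legendre (legendre \<psi>) x \<le> \<psi> x"
  unfolding legendre_def[of "legendre \<psi>"]
proof (rule SUP_least)
  fix y
  show "ereal (y \<bullet> x) - legendre \<psi> y \<le> \<psi> x"
    using legendre_upper[of x y \<psi>] nm[of x]
    by (cases "\<psi> x"; cases "legendre \<psi> y") (auto simp: inner_commute)
qed

text \<open>
  The epigraph is separated from the open half-line below \<open>(x, \<psi> x)\<close>. The separating hyperplane is
  not vertical because \<open>x\<close> is an interior point of the domain.
\<close>

lemma subgradient_exists:
  fixes \<psi> :: "'a::euclidean_space \<Rightarrow> ereal"
  assumes nm: "\<And>x. \<psi> x \<noteq> - \<infinity>" and conv: "convex_ereal \<psi>" and x: "x \<in> int_dom \<psi>"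
  obtains y where "subgradient \<psi> x y"
proof -
  define r where "r = real_of_ereal (\<psi> x)"
  have r: "\<psi> x = ereal r"
    using int_dom_finite[of \<psi>, OF nm x] by (simp add: r_def)
  define S where "S = {(z, t). \<psi> z \<le> ereal t}"
  define T where "T = {x} \<times> {..<r}"
  have "convex S"
    unfolding convex_def
  proof (intro ballI allI impI)
    fix p q and u v :: real
    assume pq: "p \<in> S" "q \<in> S" and uv: "0 \<le> u" "0 \<le> v" "u + v = 1"
    obtain z t where p: "p = (z, t)" "\<psi> z \<le> ereal t" using pq(1) by (auto simp: S_def)
    obtain z' t' where q: "q = (z', t')" "\<psi> z' \<le> ereal t'" using pq(2) by (auto simp: S_def)
    have "\<psi> (u *\<^sub>R z + v *\<^sub>R z') \<le> ereal u * \<psi> z + ereal v * \<psi> z'"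
      using conv uv unfolding convex_ereal_def by blast
    also have "\<dots> \<le> ereal u * ereal t + ereal v * ereal t'"
      using uv p q by (intro add_mono ereal_mult_left_mono) auto
    finally show "u *\<^sub>R p + v *\<^sub>R q \<in> S"
      by (simp add: S_def p q)
  qed
  moreover have "convex T"
    unfolding T_def by (intro convex_Times) auto
  moreover have "S \<noteq> {}" "T \<noteq> {}"
    using r by (auto simp: S_def T_def intro!: exI[of _ x] exI[of _ r])
  moreover have "S \<inter> T = {}"
    using r by (auto simp: S_def T_def)
  ultimately obtain w \<beta> where w: "w \<noteq> 0" "\<And>p. p \<in> S \<Longrightarrow> w \<bullet> p \<le> \<beta>" "\<And>p. p \<in> T \<Longrightarrow> \<beta> \<le> w \<bullet> p"
    using separating_hyperplane_sets[of S T] by metis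
  obtain a \<alpha> where a: "w = (a, \<alpha>)" by (cases w)
  \<comment> \<open>Here \<open>\<alpha>\<close> is the vertical component of the normal vector.\<close>
  have above: "a \<bullet> z + \<alpha> * s \<le> \<beta>" if "\<psi> z \<le> ereal s" for z s
    using w(2)[of "(z, s)"] that by (simp add: S_def a)
  have below: "\<beta> \<le> a \<bullet> x + \<alpha> * s" if "s < r" for s
    using w(3)[of "(x, s)"] that by (simp add: T_def a)
  have "\<alpha> \<le> 0"
    using above[of x r] below[of "r - 1"] by (simp add: r algebra_simps)
  moreover have "\<alpha> \<noteq> 0"
  proof
    assume 0: "\<alpha> = 0"
    then have a0: "a \<noteq> 0" using w(1) a by (auto simp: zero_prod_def)
    obtain d where d: "d > 0" "cball x d \<subseteq> int_dom \<psi>"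
      using open_int_dom x open_contains_cball by blast
    define z where "z = x + (d / norm a) *\<^sub>R a"
    have "z \<in> int_dom \<psi>"
      using d a0 by (intro subsetD[OF d(2)]) (auto simp: z_def dist_norm)
    then have "\<psi> z = ereal (real_of_ereal (\<psi> z))"
      by (rule int_dom_finite[of \<psi>, OF nm])
    then have "a \<bullet> z \<le> \<beta>"
      using above[of z "real_of_ereal (\<psi> z)"] 0 by simp
    moreover have "\<beta> \<le> a \<bullet> x"
      using below[of "r - 1"] 0 by simp
    moreover have "a \<bullet> z = a \<bullet> x + d * norm a"
      using a0 by (simp add: z_def inner_add_right power2_norm_eq_inner[symmetric] power2_eq_square)
    ultimately show False
      using d(1) a0 by (smt (verit) mult_pos_pos zero_less_norm_iff)
  qed
  ultimately have \<alpha>: "\<alpha> < 0" by simp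
  have \<beta>: "\<beta> \<le> a \<bullet> x + \<alpha> * r"
  proof (rule field_le_epsilon)
    fix e :: real assume "e > 0"
    then show "\<beta> \<le> a \<bullet> x + \<alpha> * r + e"
      using below[of "r + e / \<alpha>"] \<alpha> by (simp add: algebra_simps divide_less_0_iff)
  qed
  show thesis
  proof (rule that)
    show "subgradient \<psi> x ((1 / - \<alpha>) *\<^sub>R a)"
      unfolding subgradient_def
    proof
      fix z
      show "ereal (real_of_ereal (\<psi> x) + ((1 / - \<alpha>) *\<^sub>R a) \<bullet> (z - x)) \<le> \<psi> z"
      proof (cases "\<psi> z")
        case (real s)
        have "a \<bullet> (z - x) \<le> - \<alpha> * (s - r)"
          using above[of z s] \<beta> real by (simp add: inner_diff_right algebra_simps)
        then have "(a \<bullet> (z - x)) / - \<alpha> \<le> s - r"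
          using \<alpha> by (subst pos_divide_le_eq) (auto simp: mult.commute)
        then show ?thesis
          by (simp add: real r)
      qed (use nm in auto)
    qed
  qed
qed

lemma biconjugate_eq:
  fixes \<psi> :: "'a::euclidean_space \<Rightarrow> ereal"
  assumes nm: "\<And>x. \<psi> x \<noteq> - \<infinity>" and conv: "convex_ereal \<psi>" and x: "x \<in> int_dom \<psi>"
  shows "legendre (legendre \<psi>) x = \<psi> x"
proof (rule antisym)
  show "legendre (legendre \<psi>) x \<le> \<psi> x"
    by (rule biconjugate_le[of \<psi>, OF nm])
  obtain y where y: "subgradient \<psi> x y"
    using subgradient_exists[of \<psi>, OF nm conv x] by blast
  have r: "\<psi> x = ereal (real_of_ereal (\<psi> x))"
    by (rule int_dom_finite[of \<psi>, OF nm x])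
  have "legendre \<psi> y = ereal (x \<bullet> y - real_of_ereal (\<psi> x))"
    by (rule legendre_at_subgradient[OF r y])
  then have "ereal (y \<bullet> x) - legendre \<psi> y = \<psi> x"
    by (subst r) (simp add: inner_commute)
  then show "\<psi> x \<le> legendre (legendre \<psi>) x"
    using legendre_upper[of y x "legendre \<psi>"] by simp
qed

text \<open>
  The domain of \<open>\<psi>\<^sup>*\<^sup>*\<close> lies between that of \<open>\<psi>\<close> and its closure, and a convex set has the same
  interior as its closure.
\<close>

lemma int_dom_biconjugate:
  fixes \<psi> :: "'a::euclidean_space \<Rightarrow> ereal"
  assumes nm: "\<And>x. \<psi> x \<noteq> - \<infinity>" and conv: "convex_ereal \<psi>" and dom: "int_dom \<psi> \<noteq> {}"
  shows "int_dom (legendre (legendre \<psi>)) = int_dom \<psi>"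
proof (rule antisym)
  define D where "D = {x. \<psi> x < \<infinity>}"
  have "convex D"
    unfolding convex_def
  proof (intro ballI allI impI)
    fix x y and u v :: real
    assume xy: "x \<in> D" "y \<in> D" and uv: "0 \<le> u" "0 \<le> v" "u + v = 1"
    have "\<psi> (u *\<^sub>R x + v *\<^sub>R y) \<le> ereal u * \<psi> x + ereal v * \<psi> y"
      using conv uv unfolding convex_ereal_def by blast
    also have "\<dots> < \<infinity>"
      using xy nm[of x] nm[of y] unfolding D_def by (cases "\<psi> x"; cases "\<psi> y") auto
    finally show "u *\<^sub>R x + v *\<^sub>R y \<in> D" by (simp add: D_def)
  qed
  obtain x0 y0 where x0: "x0 \<in> int_dom \<psi>" and y0: "subgradient \<psi> x0 y0"
    using dom subgradient_exists[of \<psi>, OF nm conv] by blast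
  define c where "c = x0 \<bullet> y0 - real_of_ereal (\<psi> x0)"
  have c: "legendre \<psi> y0 = ereal c"
    unfolding c_def by (rule legendre_at_subgradient[OF int_dom_finite[of \<psi>, OF nm x0] y0])
  have "{x. legendre (legendre \<psi>) x < \<infinity>} \<subseteq> closure D"
  proof (rule subsetI, rule ccontr)
    fix x assume fin: "x \<in> {x. legendre (legendre \<psi>) x < \<infinity>}" and "x \<notin> closure D"
    then obtain a b where ab: "a \<bullet> x < b" "\<And>z. z \<in> closure D \<Longrightarrow> a \<bullet> z > b"
      using separating_hyperplane_closed_point[of "closure D" x] \<open>convex D\<close>
      by (metis closed_closure convex_closure)
    \<comment> \<open>Along the ray from \<open>y0\<close> in direction \<open>- a\<close>, the supremum defining \<open>\<psi>\<^sup>*\<^sup>* x\<close> is unbounded.\<close>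
    have ge: "ereal (y0 \<bullet> x - c + t * (b - a \<bullet> x)) \<le> legendre (legendre \<psi>) x" if t: "t \<ge> 0" for t
    proof -
      have "legendre \<psi> (y0 - t *\<^sub>R a) \<le> ereal (c - t * b)"
        unfolding legendre_def
      proof (rule SUP_least)
        fix z
        show "ereal (z \<bullet> (y0 - t *\<^sub>R a)) - \<psi> z \<le> ereal (c - t * b)"
        proof (cases "\<psi> z")
          case (real s)
          then have "z \<in> closure D"
            using closure_subset[of D] by (auto simp: D_def)
          then have "t * b \<le> t * (a \<bullet> z)"
            using ab(2) t by (intro mult_left_mono) (auto intro: less_imp_le)
          moreover have "z \<bullet> y0 - s \<le> c"
            using legendre_upper[of z y0 \<psi>] real c by simp
          ultimately show ?thesis
            by (simp add: real inner_diff_right inner_commute)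
        qed (use nm in auto)
      qed
      moreover have "legendre \<psi> (y0 - t *\<^sub>R a) \<noteq> - \<infinity>"
        by (rule legendre_not_minf) (rule int_dom_finite[of \<psi>, OF nm x0])
      ultimately have "ereal (y0 \<bullet> x - c + t * (b - a \<bullet> x))
          \<le> ereal ((y0 - t *\<^sub>R a) \<bullet> x) - legendre \<psi> (y0 - t *\<^sub>R a)"
        by (cases "legendre \<psi> (y0 - t *\<^sub>R a)") (auto simp: inner_diff_left algebra_simps)
      also have "\<dots> \<le> legendre (legendre \<psi>) x"
        by (rule legendre_upper)
      finally show ?thesis .
    qed
    obtain s where s: "legendre (legendre \<psi>) x = ereal s"
      using fin ge[of 0] by (cases "legendre (legendre \<psi>) x") auto
    define t where "t = (\<bar>s - (y0 \<bullet> x - c)\<bar> + 1) / (b - a \<bullet> x)"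
    have "t \<ge> 0" "t * (b - a \<bullet> x) = \<bar>s - (y0 \<bullet> x - c)\<bar> + 1"
      using ab(1) by (auto simp: t_def)
    then show False
      using ge[of t] s by simp
  qed
  then have "int_dom (legendre (legendre \<psi>)) \<subseteq> interior (closure D)"
    unfolding int_dom_def by (rule interior_mono)
  then show "int_dom (legendre (legendre \<psi>)) \<subseteq> int_dom \<psi>"
    using convex_interior_closure[OF \<open>convex D\<close>] by (simp add: int_dom_def D_def)
  show "int_dom \<psi> \<subseteq> int_dom (legendre (legendre \<psi>))"
    unfolding int_dom_def
  proof (intro interior_mono Collect_mono impI)
    fix x assume "\<psi> x < \<infinity>"
    with biconjugate_le[of \<psi> x, OF nm] show "legendre (legendre \<psi>) x < \<infinity>"
      by (rule le_less_trans)
  qed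
qed

lemma second_order_expansion_cong_open:
  fixes \<phi> \<phi>' :: "real^'n \<Rightarrow> real"
  assumes exp: "second_order_expansion \<phi> x g A" and U: "open U" "x \<in> U"
    and eq: "\<And>z. z \<in> U \<Longrightarrow> \<phi> z = \<phi>' z"
  shows "second_order_expansion \<phi>' x g A"
  unfolding second_order_expansion_def
proof (intro allI impI)
  fix e :: real assume e: "e > 0"
  obtain d1 where d1: "d1 > 0" "cball x d1 \<subseteq> U"
    using U open_contains_cball by blast
  obtain d2 where d2: "d2 > 0" "\<And>h. norm h \<le> d2 \<Longrightarrow>
      \<bar>\<phi> (x + h) - \<phi> x - g \<bullet> h - (1/2) * ((A *v h) \<bullet> h)\<bar> \<le> e * (norm h)\<^sup>2"
    using exp e unfolding second_order_expansion_def by meson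
  show "\<exists>d>0. \<forall>h. norm h \<le> d \<longrightarrow>
      \<bar>\<phi>' (x + h) - \<phi>' x - g \<bullet> h - (1/2) * ((A *v h) \<bullet> h)\<bar> \<le> e * (norm h)\<^sup>2"
  proof (intro exI conjI allI impI)
    show "0 < min d1 d2" using d1 d2 by simp
    fix h :: "real^'n" assume h: "norm h \<le> min d1 d2"
    then have "x + h \<in> U"
      using d1(2) by (auto simp: dist_norm)
    then show "\<bar>\<phi>' (x + h) - \<phi>' x - g \<bullet> h - (1/2) * ((A *v h) \<bullet> h)\<bar> \<le> e * (norm h)\<^sup>2"
      using d2(2)[of h] h eq U(2) by simp
  qed
qed

section \<open>The gradient map between the regular points\<close>

lemma regular_points_biconjugate:
  fixes \<psi> :: "real^'n \<Rightarrow> ereal"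
  assumes nm: "\<And>x. \<psi> x \<noteq> - \<infinity>" and conv: "convex_ereal \<psi>" and dom: "int_dom \<psi> \<noteq> {}"
    and x: "x \<in> regular_points (legendre (legendre \<psi>))"
  shows "x \<in> regular_points \<psi>" "grad \<psi> x = grad (legendre (legendre \<psi>)) x"
proof -
  have int: "x \<in> int_dom \<psi>"
    using regular_pointsD(1)[OF x] int_dom_biconjugate[of \<psi>, OF nm conv dom] by simp
  have "second_order_expansion (\<lambda>z. real_of_ereal (\<psi> z)) x
      (grad (legendre (legendre \<psi>)) x) (alexandrov_hessian (legendre (legendre \<psi>)) x)"
    using regular_pointsD(3)[OF x] open_int_dom int
    by (rule second_order_expansion_cong_open) (simp add: biconjugate_eq[of \<psi>, OF nm conv])
  from regular_pointsI[OF int regular_pointsD(2)[OF x] this regular_pointsD(4)[OF x]]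
  show "x \<in> regular_points \<psi>" "grad \<psi> x = grad (legendre (legendre \<psi>)) x"
    by auto
qed

lemma regular_points_subgradient:
  fixes \<psi> :: "real^'n \<Rightarrow> ereal"
  assumes nm: "\<And>x. \<psi> x \<noteq> - \<infinity>" and conv: "convex_ereal \<psi>" and x: "x \<in> regular_points \<psi>"
  shows "subgradient \<psi> x (grad \<psi> x)"
  by (rule GDERIV_imp_subgradient[of \<psi>, OF nm conv regular_pointsD(1)[OF x]
        second_order_expansion_imp_GDERIV[OF regular_pointsD(3)[OF x]]])

text \<open>
  Only the values of the gradient on the set of regular points enter; off this set, \<open>\<psi>\<close> need not
  be differentiable.
\<close>

lemma grad_has_derivative:
  fixes \<psi> :: "real^'n \<Rightarrow> ereal"
  assumes nm: "\<And>x. \<psi> x \<noteq> - \<infinity>" and conv: "convex_ereal \<psi>" and x: "x \<in> regular_points \<psi>"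
  shows "(grad \<psi> has_derivative (\<lambda>h. alexandrov_hessian \<psi> x *v h)) (at x within regular_points \<psi>)"
  unfolding has_derivative_within_alt
proof (intro conjI allI impI)
  show "bounded_linear (\<lambda>h. alexandrov_hessian \<psi> x *v h)"
    by (rule matrix_vector_mul_bounded_linear)
  fix e :: real assume e: "e > 0"
  obtain d where d: "d > 0" and near:
    "\<And>h k. 0 < norm h \<Longrightarrow> norm h < d \<Longrightarrow> subgradient \<psi> (x + h) (grad \<psi> x + k) \<Longrightarrow>
       norm (k - alexandrov_hessian \<psi> x *v h) \<le> e * norm h"
    using subgradient_near_expansion[of \<psi>, OF nm regular_pointsD(1)[OF x]
        regular_points_subgradient[of \<psi>, OF nm conv x] regular_pointsD(2,3)[OF x] e] by metis
  have "norm (grad \<psi> z - grad \<psi> x - alexandrov_hessian \<psi> x *v (z - x)) \<le> e * norm (z - x)"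
    if z: "z \<in> regular_points \<psi>" "norm (z - x) < d" for z
  proof (cases "z = x")
    case False
    then show ?thesis
      using near[of "z - x" "grad \<psi> z - grad \<psi> x"] z(2)
        regular_points_subgradient[of \<psi>, OF nm conv z(1)] by simp
  qed simp
  with d show "\<exists>d>0. \<forall>z\<in>regular_points \<psi>. norm (z - x) < d \<longrightarrow>
      norm (grad \<psi> z - grad \<psi> x - alexandrov_hessian \<psi> x *v (z - x)) \<le> e * norm (z - x)"
    by blast
qed

text \<open>
  The correspondence between the regular points of \<open>\<psi>\<close> and those of its Legendre transform; the
  Hessians are inverse to each other.
\<close>

lemma regular_points_legendre:
  fixes \<psi> :: "real^'n \<Rightarrow> ereal"
  assumes nm: "\<And>x. \<psi> x \<noteq> - \<infinity>" and conv: "convex_ereal \<psi>" and x: "x \<in> regular_points \<psi>"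
  defines "y \<equiv> grad \<psi> x"
  shows "y \<in> regular_points (legendre \<psi>)"
    and "grad (legendre \<psi>) y = x"
    and "legendre \<psi> y = ereal (x \<bullet> y - real_of_ereal (\<psi> x))"
    and "det (alexandrov_hessian (legendre \<psi>) y) * det (alexandrov_hessian \<psi> x) = 1"
    and "det (alexandrov_hessian \<psi> x) > 0"
proof -
  define A where "A = alexandrov_hessian \<psi> x"
  note reg = regular_pointsD[OF x, folded y_def A_def]
  have r: "\<psi> x = ereal (real_of_ereal (\<psi> x))"
    by (rule int_dom_finite[of \<psi>, OF nm reg(1)])
  have sub: "subgradient \<psi> x y"
    unfolding y_def by (rule regular_points_subgradient[of \<psi>, OF nm conv x])
  obtain B where AB: "A ** B = mat 1"
    using reg(4) invertible_right_inverse by blast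
  have BA: "B ** A = mat 1"
    using AB matrix_left_right_inverse by blast
  have symB: "transpose B = B"
  proof -
    have "transpose B ** A = mat 1"
      using arg_cong[OF AB, of transpose] by (simp add: matrix_transpose_mul reg(2))
    then have "transpose B ** (A ** B) = B"
      by (simp add: matrix_mul_assoc)
    then show ?thesis by (simp add: AB)
  qed
  note bound = legendre_expansion_bound[of \<psi>, OF nm conv reg(1) r sub reg(2) AB reg(3)]
  show val: "legendre \<psi> y = ereal (x \<bullet> y - real_of_ereal (\<psi> x))"
    by (rule legendre_at_subgradient[OF r sub])
  obtain d where d: "d > 0" "\<And>k. norm k \<le> d \<Longrightarrow> \<exists>s. legendre \<psi> (y + k) = ereal s"
    using bound[OF zero_less_one] by metis
  have int: "y \<in> int_dom (legendre \<psi>)"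
    unfolding int_dom_def
  proof (rule interiorI)
    show "open (ball y d)" "y \<in> ball y d"
      using d(1) by auto
    show "ball y d \<subseteq> {z. legendre \<psi> z < \<infinity>}"
    proof
      fix z assume "z \<in> ball y d"
      then have "norm (z - y) \<le> d"
        by (simp add: dist_norm norm_minus_commute)
      then show "z \<in> {z. legendre \<psi> z < \<infinity>}"
        using d(2)[of "z - y"] by auto
    qed
  qed
  have exp: "second_order_expansion (\<lambda>z. real_of_ereal (legendre \<psi> z)) y x B"
    unfolding second_order_expansion_def
  proof (intro allI impI)
    fix e :: real assume "e > 0"
    then obtain d where d: "d > 0" "\<And>k. norm k \<le> d \<Longrightarrow> \<exists>s. legendre \<psi> (y + k) = ereal s \<and>
        \<bar>s - (x \<bullet> y - real_of_ereal (\<psi> x)) - x \<bullet> k - (1/2) * ((B *v k) \<bullet> k)\<bar> \<le> e * (norm k)\<^sup>2"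
      using bound by metis
    have "\<bar>real_of_ereal (legendre \<psi> (y + k)) - real_of_ereal (legendre \<psi> y) - x \<bullet> k
        - (1/2) * ((B *v k) \<bullet> k)\<bar> \<le> e * (norm k)\<^sup>2" if "norm k \<le> d" for k
      using d(2)[OF that] by (auto simp: val)
    with d(1) show "\<exists>d>0. \<forall>k. norm k \<le> d \<longrightarrow>
        \<bar>real_of_ereal (legendre \<psi> (y + k)) - real_of_ereal (legendre \<psi> y) - x \<bullet> k
          - (1/2) * ((B *v k) \<bullet> k)\<bar> \<le> e * (norm k)\<^sup>2"
      by blast
  qed
  have "invertible B"
    using BA invertible_right_inverse by blast
  from regular_pointsI[OF int symB exp this]
  show "y \<in> regular_points (legendre \<psi>)" "grad (legendre \<psi>) y = x"
    and "det (alexandrov_hessian (legendre \<psi>) y) * det (alexandrov_hessian \<psi> x) = 1"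
    using BA by (auto simp: det_mul[symmetric] A_def)
  show "det (alexandrov_hessian \<psi> x) > 0"
    using positive_semidefinite_invertible_imp_coercive[OF reg(2,4)
        expansion_imp_positive_semidefinite[of \<psi>, OF nm reg(1) sub reg(3)]]
      det_pos_if_coercive unfolding A_def by metis
qed

section \<open>Duality of affine surface areas\<close>

lemma rpow_inverse:
  assumes "d * e = 1" "d > 0"
  shows "rpow d lam = d * rpow e (1 - lam)"
proof -
  have e: "e = 1 / d"
    using assms by (simp add: field_simps)
  have "rpow t a = t powr a" if "t > 0" for t a
    using that by (simp add: rpow_def)
  then show ?thesis
    using assms(2) by (simp add: e powr_diff powr_divide)
qed

theorem theorem2:
  fixes lam :: real
    and F1 F2 :: "real \<Rightarrow> real"
    and \<psi> :: "real^'n \<Rightarrow> ereal"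
  assumes F1_nonneg: "\<And>t. 0 \<le> F1 t"
    and F2_nonneg: "\<And>t. 0 \<le> F2 t"
    and not_minf: "\<And>x. \<psi> x \<noteq> - \<infinity>"
    and convex: "convex_ereal \<psi>"
    and dom: "int_dom \<psi> \<noteq> {}"
    and F1_pos: "lam < 0 \<or> lam > 1 \<Longrightarrow>
                   \<forall>x \<in> regular_points \<psi>. 0 < F1 (real_of_ereal (\<psi> x))"
    and F2_pos: "lam < 0 \<or> lam > 1 \<Longrightarrow>
                   \<forall>y \<in> regular_points (legendre \<psi>). 0 < F2 (real_of_ereal (legendre \<psi> y))"
  shows "affine_surface_area lam F1 F2 \<psi> = affine_surface_area (1 - lam) F2 F1 (legendre \<psi>)"
proof -
  let ?X = "regular_points \<psi>" and ?Y = "regular_points (legendre \<psi>)"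
  let ?T = "grad \<psi>" and ?S = "grad (legendre \<psi>)"
  let ?D = "alexandrov_hessian \<psi>" and ?E = "alexandrov_hessian (legendre \<psi>)"
  define f where "f y = ennreal (rpow (F2 (real_of_ereal (legendre \<psi> y))) (1 - (1 - lam))
      * rpow (F1 (y \<bullet> ?S y - real_of_ereal (legendre \<psi> y))) (1 - lam)
      * rpow (det (?E y)) (1 - lam))" for y
  obtain x0 where "x0 \<in> int_dom \<psi>"
    using dom by blast
  then have nm': "legendre \<psi> y \<noteq> - \<infinity>" for y
    by (intro legendre_not_minf[where x=x0]) (rule int_dom_finite[of \<psi>, OF not_minf])
  have conv': "convex_ereal (legendre \<psi>)"
    by (rule convex_ereal_legendre[of \<psi>, OF not_minf])
  note X = regular_points_legendre[of \<psi>, OF not_minf convex]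
  note Y = regular_points_legendre[of "legendre \<psi>", OF nm' conv']
  note biconj = regular_points_biconjugate[of \<psi>, OF not_minf convex dom]
  have S_im: "?S y \<in> ?X" and TS: "?T (?S y) = y" if "y \<in> ?Y" for y
    using biconj[OF Y(1)[OF that]] Y(2)[OF that] by simp_all
  have "affine_surface_area lam F1 F2 \<psi>
      = (\<integral>\<^sup>+x\<in>?X. ennreal \<bar>det (?D x)\<bar> * f (?T x) \<partial>lebesgue)"
    unfolding affine_surface_area_def
  proof (intro nn_integral_cong)
    fix x
    have "ennreal (rpow (F1 (real_of_ereal (\<psi> x))) (1 - lam)
        * rpow (F2 (x \<bullet> ?T x - real_of_ereal (\<psi> x))) lam * rpow (det (?D x)) lam)
        = ennreal \<bar>det (?D x)\<bar> * f (?T x)" if x: "x \<in> ?X"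
    proof -
      have "rpow (det (?D x)) lam = det (?D x) * rpow (det (?E (?T x))) (1 - lam)"
        using X(4,5)[OF x] by (intro rpow_inverse) (simp_all add: mult.commute)
      then show ?thesis
        using X(2,3,5)[OF x]
        by (simp add: f_def ennreal_mult'[symmetric] inner_commute algebra_simps)
    qed
    then show "ennreal (rpow (F1 (real_of_ereal (\<psi> x))) (1 - lam)
        * rpow (F2 (x \<bullet> ?T x - real_of_ereal (\<psi> x))) lam * rpow (det (?D x)) lam) * indicator ?X x
        = ennreal \<bar>det (?D x)\<bar> * f (?T x) * indicator ?X x"
      by (simp add: indicator_def)
  qed
  also have "\<dots> = (\<integral>\<^sup>+y\<in>?Y. f y \<partial>lebesgue)"
  proof (rule nn_integral_change_of_variables_eq[where S = ?S and E = ?E])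
    show "(?T has_derivative (\<lambda>h. ?D x *v h)) (at x within ?X)" if "x \<in> ?X" for x
      by (rule grad_has_derivative[of \<psi>, OF not_minf convex that])
    show "(?S has_derivative (\<lambda>h. ?E y *v h)) (at y within ?Y)" if "y \<in> ?Y" for y
      by (rule grad_has_derivative[of "legendre \<psi>", OF nm' conv' that])
    show "?T x \<in> ?Y" "?S (?T x) = x" if "x \<in> ?X" for x
      using X(1,2)[OF that] by auto
    show "?S y \<in> ?X" "?T (?S y) = y" if "y \<in> ?Y" for y
      using S_im TS that by auto
    show "det (?E y) * det (?D (?S y)) = 1" if "y \<in> ?Y" for y
      using X(4)[OF S_im[OF that]] TS[OF that] by simp
  qed
  also have "\<dots> = affine_surface_area (1 - lam) F2 F1 (legendre \<psi>)"
    unfolding affine_surface_area_def f_def ..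
  finally show ?thesis .
qed

end
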